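(* For every integer $n\ge 2$, $$f^{\sigma_{3n-2}}=\frac{1}{2n-1}\sum_{i=1}^{n-1}\binom{3n-2}{3i-1}f^{\sigma_{3i-1}}f^{\sigma_{3n-3i-1}}$$ and $$f^{\tau_{3n}}=\frac{1}{2n+1}\sum_{i=1}^{n-1}\binom{3n}{3i}f^{\tau_{3i}}f^{\tau_{3n-3i}},$$ where the shapes $\sigma_{k}$ and $\tau_{3k}$ are as defined in the context.
   Context: Partitions are identified with their Young diagrams (English notation, left-justified rows). For a skew shape $\lambda/\mu$ with $N$ boxes, $f^{\lambda/\mu}$ denotes the number of standard Young tableaux of shape $\lambda/\mu$, i.e. fillings of the boxes with $1,\dots,N$, each used once, increasing along rows (left to right) and down columns. The shapes (each index equals the number of boxes): - $\sigma_1=(1)$, $\sigma_4=(2,2)$, and for $m\ge 3$, $\sigma_{3m-2}=(m,m,m-1,m-2,\dots,3,2)/(m-2,m-3,\dots,1,0,0)$. - $\sigma_2=(1,1)$, $\sigma_5=(2,2,2)/(1,0,0)$, and for $m\ge 3$, $\sigma_{3m-1}=(m,m,m,m-1,m-2,\dots,3,2)/(m-1,m-2,\dots,1,0,0)$. - $\tau_3=(2,2)/(1,0)$, and for $k\ge 2$, $\tau_{3k}$ is the skew shape $(m,m,m,m-1,m-2,\dots,3)/(m-1,m-2,\dots,1,0)$ with $m=k+1$ (so it has $3k$ boxes; e.g. $\tau_6=(3,3,3)/(2,1,0)$, $\tau_9=(4,4,4,3)/(3,2,1,0)$). *)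

theory Defs
  imports Complex_Main "HOL-Library.FuncSet"
begin

text \<open>
  A partition is the list of its row lengths, in weakly decreasing order, possibly padded by zeros.
  The box \<open>(i, j)\<close> is in row \<open>i\<close> and column \<open>j\<close>, both counted from 0, with rows going downwards
  (English notation).
\<close>

definition young_diagram :: "nat list \<Rightarrow> (nat \<times> nat) set" where
  "young_diagram la = {(i, j). i < length la \<and> j < la ! i}"

definition skew_shape :: "nat list \<Rightarrow> nat list \<Rightarrow> (nat \<times> nat) set" where
  "skew_shape la mu = young_diagram la - young_diagram mu"

text \<open>
  Fillings are extensional (equal to \<open>undefined\<close> outside the shape), so that each tableau
  corresponds to exactly one function and counting functions counts tableaux.
\<close>

definition standard_young_tableaux :: "(nat \<times> nat) set \<Rightarrow> (nat \<times> nat \<Rightarrow> nat) set" where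
  "standard_young_tableaux D =
     {T \<in> extensional D.
        bij_betw T D {1..card D} \<and>
        (\<forall>i j j'. (i, j) \<in> D \<and> (i, j') \<in> D \<and> j < j' \<longrightarrow> T (i, j) < T (i, j')) \<and>
        (\<forall>i i' j. (i, j) \<in> D \<and> (i', j) \<in> D \<and> i < i' \<longrightarrow> T (i, j) < T (i', j))}"

definition num_syt :: "(nat \<times> nat) set \<Rightarrow> nat" where
  "num_syt D = card (standard_young_tableaux D)"

text \<open>
  The index is the number of boxes, so \<open>sigma (3 * m - 2)\<close> and \<open>sigma (3 * m - 1)\<close> (for
  \<open>m \<ge> 1\<close>) and \<open>tau (3 * k)\<close> (for \<open>k \<ge> 1\<close>) are the shapes considered; \<open>m = (k + 2) div 3\<close>
  below recovers \<open>m\<close> from the index \<open>k\<close> of \<open>sigma\<close>. No shape is attached to other indices.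
  Note that \<open>rev [a..<b]\<close> is the decreasing list \<open>b - 1, ..., a\<close>.
\<close>

definition sigma :: "nat \<Rightarrow> (nat \<times> nat) set" where
  "sigma k =
     (let m = (k + 2) div 3 in
      if k = 1 then skew_shape [1] []
      else if k = 2 then skew_shape [1, 1] []
      else if k = 4 then skew_shape [2, 2] []
      else if k = 5 then skew_shape [2, 2, 2] [1, 0, 0]
      else if m \<ge> 3 \<and> k = 3 * m - 2 then
        skew_shape ([m, m] @ rev [2..<m]) (rev [1..<m - 1] @ [0, 0])
      else if m \<ge> 3 \<and> k = 3 * m - 1 then
        skew_shape ([m, m, m] @ rev [2..<m]) (rev [1..<m] @ [0, 0])
      else undefined)"

definition tau :: "nat \<Rightarrow> (nat \<times> nat) set" where
  "tau k =
     (let m = k div 3 + 1 in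
      if k = 3 then skew_shape [2, 2] [1, 0]
      else if m \<ge> 3 \<and> k = 3 * (m - 1) then
        skew_shape ([m, m, m] @ rev [3..<m]) (rev [1..<m] @ [0])
      else undefined)"

lemma sigma_7: "sigma 7 = skew_shape [3, 3, 2] [1, 0, 0]"
  and sigma_8: "sigma 8 = skew_shape [3, 3, 3, 2] [2, 1, 0, 0]"
  and tau_6: "tau 6 = skew_shape [3, 3, 3] [2, 1, 0]"
  and tau_9: "tau 9 = skew_shape [4, 4, 4, 3] [3, 2, 1, 0]"
  by (simp_all add: sigma_def tau_def upt_rec flip: numeral_2_eq_2 numeral_3_eq_3)

end

(* The number of standard tableaux of a shape with N boxes is N! times the limit, as m grows, of the
   proportion of weakly monotone fillings among all m^N fillings. All three families of
   shapes are strips of three antidiagonals. Once the entries y of the middle antidiagonal are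
   chosen, the outer entries are independent, and the outer boxes between two
   neighbours u, v of the middle contribute min(u,v) (m - max(u,v)), which is the Green function of
   the discrete Dirichlet Laplacian on {0..m}. In the limit, counting tableaux therefore amounts
   to iterating the inverse of -d^2/dx^2 on [0,1], starting from 1 or from x. The generating functions
   of these iterates are cos (t (x - 1/2)) / cos (t/2) and t sin (t x) / sin t; they express
   the tableau counts through the Taylor coefficients of tan (t/2) and of t cot t. The two
   recurrences are the Riccati equations of these two functions. *)

theory Submission
  imports Defs "HOL-Computational_Algebra.Formal_Power_Series" "HOL-Library.Infinite_Set"
begin

section \<open>Monotone fillings and linear extensions\<close>

text \<open>Counting on a grid replaces volumes of polytopes by finite sums. The iterated sums are
  never evaluated: they are compared with known solutions of the differential equation, with an
  error O(1/m) for each fixed number of iterations, and primitives of these solutions replace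
  integrals. The start is 1 or x according to whether an extra box sits next to the first middle
  box, since that box has as many values as the entry beside it allows. One more middle box brings
  three boxes, hence a factor m^3, but only one inversion of -d^2/dx^2, hence t^2. This is why about
  3n boxes belong to a coefficient of index about 2n. Dividing by N! absorbs the binomial
  coefficients into products of series; the factors 2n - 1 and 2n + 1 come from differentiating in
  t, in the second case together with the linear terms of the Riccati equation. The two sigma
  families use different boundary value problems, but the half-angle formula for the tangent brings
  both to tan (t/2).\<close>

text \<open>Linear extensions with labels in \<open>S\<close>. The label set is kept general because
  an injective filling may use any subset of the available values.\<close>

definition strict_bijections :: "'a set \<Rightarrow> ('a \<times> 'a) set \<Rightarrow> nat set \<Rightarrow> ('a \<Rightarrow> nat) set" where
  "strict_bijections D R S =
     {f \<in> extensional D. bij_betw f D S \<and> (\<forall>(a, b) \<in> R. f a < f b)}"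

definition weak_maps :: "'a set \<Rightarrow> ('a \<times> 'a) set \<Rightarrow> nat set \<Rightarrow> ('a \<Rightarrow> nat) set" where
  "weak_maps D R V = {f \<in> D \<rightarrow>\<^sub>E V. \<forall>(a, b) \<in> R. f a \<le> f b}"

lemma strict_bijections_compose:
  assumes f: "f \<in> strict_bijections D R S" and R: "R \<subseteq> D \<times> D"
    and g: "bij_betw g S S'" "strict_mono_on S g"
  shows "restrict (g \<circ> f) D \<in> strict_bijections D R S'"
proof -
  have bij: "bij_betw f D S" and mono: "\<forall>(a, b) \<in> R. f a < f b"
    using f by (auto simp: strict_bijections_def)
  have "bij_betw (g \<circ> f) D S'"
    using bij g(1) by (rule bij_betw_trans)
  then have "bij_betw (restrict (g \<circ> f) D) D S'"
    by (simp cong: bij_betw_cong)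
  moreover have "g (f a) < g (f b)" if "(a, b) \<in> R" for a b
    using that R mono bij_betwE[OF bij] by (intro strict_mono_onD[OF g(2)]) auto
  ultimately show ?thesis
    using R by (auto simp: strict_bijections_def)
qed

text \<open>Only the relative order of the labels matters: composition with the increasing
  enumeration of \<open>S\<close> and composition with its inverse undo each other.\<close>

lemma card_strict_bijections_eq:
  assumes R: "R \<subseteq> D \<times> D" and S: "finite S" "card S = n"
  shows "card (strict_bijections D R S) = card (strict_bijections D R {..<n})"
proof -
  obtain h where h: "bij_betw h {..<n} S" "strict_mono_on {..<n} h"
    using ex_bij_betw_strict_mono_card[OF S(1)] S(2) by metis
  define k where "k = inv_into {..<n} h"
  have k: "bij_betw k S {..<n}"
    unfolding k_def using h(1) by (rule bij_betw_inv_into)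
  have hk: "h (k y) = y" if "y \<in> S" for y
    using that h(1) by (simp add: k_def bij_betw_inv_into_right)
  have kh: "k (h x) = x" if "x \<in> {..<n}" for x
    using bij_betw_inv_into_left[OF h(1) that] by (simp add: k_def)
  have k_mono: "strict_mono_on S k"
  proof (rule strict_mono_onI)
    fix x y assume xy: "x \<in> S" "y \<in> S" "x < y"
    show "k x < k y"
    proof (rule ccontr)
      assume "\<not> k x < k y"
      moreover have "k x \<in> {..<n}" "k y \<in> {..<n}"
        using bij_betwE[OF k] xy by blast+
      ultimately have "h (k y) \<le> h (k x)"
        by (intro strict_mono_on_leD[OF h(2)]) (simp_all add: not_less)
      then show False using xy hk by simp
    qed
  qed
  have *: "f \<in> extensional D" "\<And>x. x \<in> D \<Longrightarrow> f x \<in> T"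
    if "f \<in> strict_bijections D R T" for f T
    using that by (auto simp: strict_bijections_def dest: bij_betwE)
  have "bij_betw (\<lambda>f. restrict (h \<circ> f) D) (strict_bijections D R {..<n}) (strict_bijections D R S)"
  proof (rule bij_betw_byWitness[where f' = "\<lambda>f. restrict (k \<circ> f) D"])
    show "\<forall>f\<in>strict_bijections D R {..<n}. restrict (k \<circ> restrict (h \<circ> f) D) D = f"
    proof
      fix f assume "f \<in> strict_bijections D R {..<n}"
      note this[THEN *(1)] this[THEN *(2)]
      then show "restrict (k \<circ> restrict (h \<circ> f) D) D = f"
        by (intro extensionalityI[where A = D]) (simp_all add: kh)
    qed
    show "\<forall>f\<in>strict_bijections D R S. restrict (h \<circ> restrict (k \<circ> f) D) D = f"
    proof
      fix f assume "f \<in> strict_bijections D R S"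
      note this[THEN *(1)] this[THEN *(2)]
      then show "restrict (h \<circ> restrict (k \<circ> f) D) D = f"
        by (intro extensionalityI[where A = D]) (simp_all add: hk)
    qed
    show "(\<lambda>f. restrict (h \<circ> f) D) ` strict_bijections D R {..<n} \<subseteq> strict_bijections D R S"
      using strict_bijections_compose[OF _ R h] by (intro image_subsetI)
    show "(\<lambda>f. restrict (k \<circ> f) D) ` strict_bijections D R S \<subseteq> strict_bijections D R {..<n}"
      using strict_bijections_compose[OF _ R k k_mono] by (intro image_subsetI)
  qed
  then show ?thesis
    by (simp add: bij_betw_same_card)
qed

text \<open>On pairs of distinct elements injectivity turns weak inequalities into strict ones, so
  such a map amounts to its image, a subset of \<open>V\<close> of size \<open>card D\<close>, and a
  linear extension onto that image.\<close>

lemma card_injective_weak_maps: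
  assumes D: "finite D" and R: "R \<subseteq> D \<times> D" "irrefl R" and V: "finite V"
  shows "card {f \<in> weak_maps D R V. inj_on f D} =
           (card V choose card D) * card (strict_bijections D R {1..card D})"
proof -
  let ?I = "{S. S \<subseteq> V \<and> card S = card D}"
  have eq: "{f \<in> weak_maps D R V. inj_on f D} = (\<Union>S\<in>?I. strict_bijections D R S)"
  proof (intro equalityI subsetI)
    fix f assume f: "f \<in> {f \<in> weak_maps D R V. inj_on f D}"
    have "f a < f b" if "(a, b) \<in> R" for a b
    proof -
      have "f a \<le> f b" "a \<in> D" "b \<in> D" "a \<noteq> b"
        using f that R by (auto simp: weak_maps_def irrefl_def)
      then show ?thesis using f by (auto simp: inj_on_eq_iff order.strict_iff_order)
    qed
    then have "f \<in> strict_bijections D R (f ` D)" "f ` D \<in> ?I"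
      using f by (auto simp: strict_bijections_def weak_maps_def PiE_def inj_on_imp_bij_betw card_image)
    then show "f \<in> (\<Union>S\<in>?I. strict_bijections D R S)" by blast
  next
    fix f assume "f \<in> (\<Union>S\<in>?I. strict_bijections D R S)"
    then obtain S where "S \<subseteq> V" "f \<in> strict_bijections D R S" by auto
    then show "f \<in> {f \<in> weak_maps D R V. inj_on f D}"
      by (auto simp: strict_bijections_def weak_maps_def PiE_def bij_betw_def less_imp_le)
  qed
  have "finite {f \<in> weak_maps D R V. inj_on f D}"
    by (rule finite_subset[of _ "D \<rightarrow>\<^sub>E V"]) (use D V in \<open>auto simp: weak_maps_def intro: finite_PiE\<close>)
  then have fin: "finite (strict_bijections D R S)" if "S \<in> ?I" for S
    using that unfolding eq by (meson UN_upper finite_subset)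
  have "card (\<Union>S\<in>?I. strict_bijections D R S) = (\<Sum>S\<in>?I. card (strict_bijections D R S))"
  proof (rule card_UN_disjoint)
    show "\<forall>S\<in>?I. \<forall>T\<in>?I. S \<noteq> T \<longrightarrow> strict_bijections D R S \<inter> strict_bijections D R T = {}"
      by (auto simp: strict_bijections_def bij_betw_def)
  qed (use V fin in auto)
  also have "\<dots> = (\<Sum>S\<in>?I. card (strict_bijections D R {1..card D}))"
  proof (intro sum.cong refl)
    fix S assume "S \<in> ?I"
    then have "finite S" "card S = card D"
      using V finite_subset by auto
    then show "card (strict_bijections D R S) = card (strict_bijections D R {1..card D})"
      using card_strict_bijections_eq[OF R(1)] by (metis card_atLeastAtMost diff_Suc_1 finite_atLeastAtMost)
  qed
  also have "\<dots> = (card V choose card D) * card (strict_bijections D R {1..card D})"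
    using n_subsets[OF V, of "card D"] by simp
  finally show ?thesis
    unfolding eq .
qed

section \<open>Almost all fillings are injective\<close>

lemma binomial_ratio_tendsto:
  "(\<lambda>m. real (m - 1 choose n) * fact n / real m ^ n) \<longlonglongrightarrow> 1"
proof -
  have "(\<lambda>m. \<Prod>i<n. (real m - 1 - real i) / real m) \<longlonglongrightarrow> (\<Prod>i<n. 1)"
  proof (rule tendsto_prod)
    fix i
    have "(\<lambda>m. 1 - (1 + real i) * inverse (real m)) \<longlonglongrightarrow> 1 - (1 + real i) * 0"
      by (intro tendsto_intros lim_inverse_n)
    moreover have "\<forall>\<^sub>F m in sequentially.
        1 - (1 + real i) * inverse (real m) = (real m - 1 - real i) / real m"
      using eventually_gt_at_top[of 0] by eventually_elim (simp add: field_simps)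
    ultimately have "(\<lambda>m. (real m - 1 - real i) / real m) \<longlonglongrightarrow> 1 - (1 + real i) * 0"
      by (rule Lim_transform_eventually)
    then show "(\<lambda>m. (real m - 1 - real i) / real m) \<longlonglongrightarrow> 1" by simp
  qed
  moreover have "\<forall>\<^sub>F m in sequentially. (\<Prod>i<n. (real m - 1 - real i) / real m) =
      real (m - 1 choose n) * fact n / real m ^ n"
    using eventually_gt_at_top[of 0]
  proof eventually_elim
    case (elim m)
    then have "real (m - 1 choose n) = (real m - 1) gchoose n"
      by (simp add: binomial_gbinomial of_nat_diff)
    then have "real (m - 1 choose n) * fact n = (\<Prod>i<n. real m - 1 - real i)"
      by (simp only: gbinomial_prod_rev atLeast0LessThan) simp
    then show ?case
      by (simp add: prod_dividef)
  qed
  ultimately have "(\<lambda>m. real (m - 1 choose n) * fact n / real m ^ n) \<longlonglongrightarrow> (\<Prod>i<n. 1)"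
    by (rule Lim_transform_eventually)
  then show ?thesis by simp
qed

text \<open>A sandwich: the injective weak maps are counted exactly, and the remaining ones are at
  most as many as all non-injective maps, whose proportion tends to 0.\<close>

lemma weak_maps_asymptotics:
  assumes D: "finite D" and R: "R \<subseteq> D \<times> D" "irrefl R"
  shows "(\<lambda>m. real (card (weak_maps D R {1..<m})) / real m ^ card D)
           \<longlonglongrightarrow> real (card (strict_bijections D R {1..card D})) / fact (card D)"
proof -
  let ?n = "card D" and ?e = "real (card (strict_bijections D R {1..card D}))"
  define b where "b m = real (m - 1 choose ?n) * fact ?n" for m
  have b: "(\<lambda>m. b m / real m ^ ?n) \<longlonglongrightarrow> 1"
    unfolding b_def by (rule binomial_ratio_tendsto)
  have bounds: "b m / real m ^ ?n * (?e / fact ?n) \<le> real (card (weak_maps D R {1..<m})) / real m ^ ?n"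
     "real (card (weak_maps D R {1..<m})) / real m ^ ?n \<le> b m / real m ^ ?n * (?e / fact ?n) + (1 - b m / real m ^ ?n)"
    if "m > 0" for m
  proof -
    let ?V = "{1..<m}" and ?W = "weak_maps D R {1..<m}"
    let ?I = "{f \<in> D \<rightarrow>\<^sub>E ?V. inj_on f D}"
    have fin: "finite (D \<rightarrow>\<^sub>E ?V)" using D by (intro finite_PiE) auto
    have W: "?W \<subseteq> D \<rightarrow>\<^sub>E ?V" by (auto simp: weak_maps_def)
    \<comment> \<open>The empty relation makes the same counting lemma count all injective
      maps.\<close>
    have "card ?I = (m - 1 choose ?n) * card (strict_bijections D {} {1..card D})"
      using card_injective_weak_maps[OF D, of "{}" ?V] by (simp add: weak_maps_def irrefl_def)
    moreover have "strict_bijections D {} {1..card D} = {f \<in> D \<rightarrow>\<^sub>E {1..card D}. inj_on f D}"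
    proof -
      have "f ` D = {1..card D}" if "f ` D \<subseteq> {1..card D}" "inj_on f D" for f
        using that by (intro card_subset_eq) (auto simp: card_image)
      then have "bij_betw f D {1..card D} \<longleftrightarrow> f \<in> D \<rightarrow> {1..card D} \<and> inj_on f D" for f
        unfolding bij_betw_def image_subset_iff_funcset[symmetric] by blast
      then show ?thesis
        by (auto simp: strict_bijections_def PiE_iff extensional_def Pi_iff)
    qed
    moreover have "card {f \<in> D \<rightarrow>\<^sub>E {1..card D}. inj_on f D} = fact ?n"
      using card_inj_on_subset_funcset[OF D, of "{1..card D}" D] by (simp add: fact_prod_rev)
    ultimately have cI: "real (card ?I) = b m"
      by (simp add: b_def)
    have cWI: "real (card {f \<in> ?W. inj_on f D}) = b m * (?e / fact ?n)"
      using card_injective_weak_maps[OF D R, of ?V] by (simp add: b_def)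
    have "real (card ?W) \<ge> b m * (?e / fact ?n)"
      unfolding cWI[symmetric] of_nat_le_iff
      by (intro card_mono finite_subset[OF W fin]) auto
    then have "b m * (?e / fact ?n) / real m ^ ?n \<le> real (card ?W) / real m ^ ?n"
      by (rule divide_right_mono) simp
    then show "b m / real m ^ ?n * (?e / fact ?n) \<le> real (card ?W) / real m ^ ?n"
      by (simp add: mult.commute)
    have "?W \<subseteq> {f \<in> ?W. inj_on f D} \<union> ((D \<rightarrow>\<^sub>E ?V) - ?I)"
      using W by auto
    then have "card ?W \<le> card ({f \<in> ?W. inj_on f D} \<union> ((D \<rightarrow>\<^sub>E ?V) - ?I))"
      by (intro card_mono) (use fin finite_subset[OF W fin] in auto)
    also have "\<dots> \<le> card {f \<in> ?W. inj_on f D} + card ((D \<rightarrow>\<^sub>E ?V) - ?I)"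
      by (rule card_Un_le)
    also have "card ((D \<rightarrow>\<^sub>E ?V) - ?I) = card (D \<rightarrow>\<^sub>E ?V) - card ?I"
      using fin by (intro card_Diff_subset) auto
    finally have "real (card ?W) \<le>
        real (card {f \<in> ?W. inj_on f D}) + real (card (D \<rightarrow>\<^sub>E ?V) - card ?I)"
      by (simp only: of_nat_add[symmetric] of_nat_le_iff)
    also have "\<dots> = b m * (?e / fact ?n) + (real (card (D \<rightarrow>\<^sub>E ?V)) - b m)"
      using card_mono[OF fin, of ?I] unfolding cWI cI[symmetric] by (subst of_nat_diff) auto
    also have "real (card (D \<rightarrow>\<^sub>E ?V)) \<le> real m ^ ?n"
      using D by (simp add: card_funcsetE power_mono)
    finally have "real (card ?W) \<le> b m * (?e / fact ?n) + (real m ^ ?n - b m)" by simp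
    then have "real (card ?W) / real m ^ ?n \<le> (b m * (?e / fact ?n) + (real m ^ ?n - b m)) / real m ^ ?n"
      by (rule divide_right_mono) simp
    then show "real (card ?W) / real m ^ ?n \<le> b m / real m ^ ?n * (?e / fact ?n) + (1 - b m / real m ^ ?n)"
      using that by (simp add: add_divide_distrib diff_divide_distrib mult.commute)
  qed
  show ?thesis
  proof (rule real_tendsto_sandwich)
    show "\<forall>\<^sub>F m in sequentially. b m / real m ^ ?n * (?e / fact ?n) \<le> real (card (weak_maps D R {1..<m})) / real m ^ ?n"
      using eventually_gt_at_top[of 0] by eventually_elim (rule bounds)
    show "\<forall>\<^sub>F m in sequentially. real (card (weak_maps D R {1..<m})) / real m ^ ?n
        \<le> b m / real m ^ ?n * (?e / fact ?n) + (1 - b m / real m ^ ?n)"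
      using eventually_gt_at_top[of 0] by eventually_elim (rule bounds)
    have "(\<lambda>m. b m / real m ^ ?n * (?e / fact ?n)) \<longlonglongrightarrow> 1 * (?e / fact ?n)"
      by (intro tendsto_mult_right b)
    then show "(\<lambda>m. b m / real m ^ ?n * (?e / fact ?n)) \<longlonglongrightarrow> ?e / fact ?n" by simp
    have "(\<lambda>m. b m / real m ^ ?n * (?e / fact ?n) + (1 - b m / real m ^ ?n)) \<longlonglongrightarrow> 1 * (?e / fact ?n) + (1 - 1)"
      by (intro tendsto_add tendsto_diff tendsto_mult_right b tendsto_const)
    then show "(\<lambda>m. b m / real m ^ ?n * (?e / fact ?n) + (1 - b m / real m ^ ?n)) \<longlonglongrightarrow> ?e / fact ?n" by simp
  qed
qed

section \<open>The discrete Green function\<close>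

text \<open>Normalised so that the second difference in \<open>u\<close> is \<open>- m\<close> at
  \<open>u = v\<close> and 0 at the other interior points; in this form the values are numbers of
  fillings.\<close>

definition green :: "nat \<Rightarrow> nat \<Rightarrow> nat \<Rightarrow> real" where
  "green m u v = real (min u v) * (real m - real (max u v))"

text \<open>Transfer-matrix recursion: the total weight of chains of \<open>k + 1\<close> middle
  entries that end in \<open>v\<close>, where \<open>e\<close> weighs the first entry.\<close>

fun transfer :: "nat \<Rightarrow> (nat \<Rightarrow> real) \<Rightarrow> nat \<Rightarrow> nat \<Rightarrow> real" where
  "transfer m e 0 v = e v"
| "transfer m e (Suc k) v = (\<Sum>u\<in>{1..<m}. green m u v * transfer m e k u)"

lemma sum_PiE_insert:
  assumes "a \<notin> A"
  shows "(\<Sum>f\<in>PiE (insert a A) S. F f) = (\<Sum>f\<in>PiE A S. \<Sum>v\<in>S a. F (f(a := v)))"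
proof -
  have "(\<Sum>f\<in>PiE (insert a A) S. F f) = (\<Sum>(v, f)\<in>S a \<times> PiE A S. F (f(a := v)))"
    unfolding PiE_insert_eq using inj_combinator[OF assms]
    by (subst sum.reindex) (auto simp: case_prod_unfold)
  then show ?thesis
    by (simp add: sum.cartesian_product[symmetric] sum.swap[of _ "S a"])
qed

text \<open>The final weight \<open>e'\<close> is arbitrary so that the induction can absorb the sum
  over the last entry into it.\<close>

lemma sum_chain_eq_transfer:
  "(\<Sum>y\<in>{..k} \<rightarrow>\<^sub>E {1..<m}. e (y 0) * (\<Prod>a<k. green m (y a) (y (Suc a))) * e' (y k)) =
     (\<Sum>v\<in>{1..<m}. transfer m e k v * e' v)"
proof (induction k arbitrary: e')
  case 0
  have "{..0::nat} = insert 0 {}" by auto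
  moreover have "(\<Sum>y\<in>{0::nat} \<rightarrow>\<^sub>E {1..<m}. e (y 0) * e' (y 0)) = (\<Sum>v\<in>{1..<m}. e v * e' v)"
    using sum_PiE_insert[of "0::nat" "{}" "\<lambda>y. e (y 0) * e' (y 0)" "\<lambda>_. {1..<m}"] by simp
  ultimately show ?case by simp
next
  case (Suc k)
  have "(\<Sum>y\<in>{..Suc k} \<rightarrow>\<^sub>E {1..<m}. e (y 0) * (\<Prod>a<Suc k. green m (y a) (y (Suc a))) * e' (y (Suc k))) =
     (\<Sum>y\<in>{..k} \<rightarrow>\<^sub>E {1..<m}. \<Sum>v\<in>{1..<m}.
        e (y 0) * (\<Prod>a<k. green m (y a) (y (Suc a))) * green m (y k) v * e' v)"
    by (simp add: atMost_Suc sum_PiE_insert mult_ac)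
  also have "\<dots> = (\<Sum>y\<in>{..k} \<rightarrow>\<^sub>E {1..<m}.
        e (y 0) * (\<Prod>a<k. green m (y a) (y (Suc a))) * (\<Sum>v\<in>{1..<m}. green m (y k) v * e' v))"
    by (simp add: sum_distrib_left mult_ac)
  also have "\<dots> = (\<Sum>u\<in>{1..<m}. transfer m e k u * (\<Sum>v\<in>{1..<m}. green m u v * e' v))"
    by (rule Suc.IH)
  also have "\<dots> = (\<Sum>v\<in>{1..<m}. transfer m e (Suc k) v * e' v)"
    by (simp add: sum_distrib_left sum_distrib_right mult_ac) (rule sum.swap)
  finally show ?case .
qed

text \<open>Discrete Green identity: two summations by parts leave only boundary terms.\<close>

lemma sum_mult_second_difference:
  fixes f g :: "nat \<Rightarrow> real"
  shows "(\<Sum>u=1..n. f u * (g (u + 1) - 2 * g u + g (u - 1))) =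
         (\<Sum>u=1..n. g u * (f (u + 1) - 2 * f u + f (u - 1)))
         + f n * g (n + 1) - f (n + 1) * g n + f 1 * g 0 - f 0 * g 1"
  by (induction n) (simp_all add: algebra_simps)

text \<open>Summation by parts moves the second difference onto the Green function, where it is
  concentrated at \<open>v\<close>; the boundary terms interpolate \<open>g 0\<close> and
  \<open>g m\<close> linearly. If both vanish, the Green sum inverts the second difference up to the
  factor \<open>- m\<close>.\<close>

lemma green_second_difference:
  fixes g :: "nat \<Rightarrow> real"
  assumes "v \<le> m"
  shows "(\<Sum>u\<in>{1..<m}. green m u v * (g (u + 1) - 2 * g u + g (u - 1))) =
           (real m - real v) * g 0 + real v * g m - real m * g v"
\<comment> \<open>In these cases the Green function vanishes on the whole range of
  summation.\<close>
proof (cases "m = 0 \<or> v = 0 \<or> v = m")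
  case True
  then show ?thesis using assms by (auto simp: green_def max_def min_def)
next
  case False
  then have v: "v \<in> {1..m - 1}" and m: "m - 1 + 1 = m" using assms by auto
  have d: "green m (u + 1) v - 2 * green m u v + green m (u - 1) v = (if u = v then - real m else 0)"
    if u: "u \<in> {1..m - 1}" for u
  proof -
    obtain w where w: "u = Suc w" using u by (cases u) auto
    consider "Suc w < v" | "Suc w = v" | "w = v" | "w > v" by linarith
    then show ?thesis
      unfolding w using v by cases (auto simp: green_def max_def min_def algebra_simps)
  qed
  have "(\<Sum>u\<in>{1..<m}. green m u v * (g (u + 1) - 2 * g u + g (u - 1))) =
        (\<Sum>u=1..m - 1. green m u v * (g (u + 1) - 2 * g u + g (u - 1)))"
    using False by (intro sum.cong) auto
  also have "\<dots> = (\<Sum>u=1..m - 1. g u * (if u = v then - real m else 0))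
      + green m (m - 1) v * g m - green m m v * g (m - 1) + green m 1 v * g 0 - green m 0 v * g 1"
  proof -
    have "(\<Sum>u=1..m - 1. g u * (green m (u + 1) v - 2 * green m u v + green m (u - 1) v)) =
        (\<Sum>u=1..m - 1. g u * (if u = v then - real m else 0))"
      using d by (intro sum.cong) auto
    with sum_mult_second_difference[of "\<lambda>u. green m u v" g "m - 1"] show ?thesis
      by (simp only: m)
  qed
  also have "(\<Sum>u=1..m - 1. g u * (if u = v then - real m else 0)) = - real m * g v"
    using v by (simp add: if_distrib sum.delta cong: if_cong)
  finally have eq: "(\<Sum>u\<in>{1..<m}. green m u v * (g (u + 1) - 2 * g u + g (u - 1))) =
      - real m * g v + green m (m - 1) v * g m - green m m v * g (m - 1) + green m 1 v * g 0 - green m 0 v * g 1" .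
  have "green m (m - 1) v = real v" "green m m v = 0" "green m 1 v = real m - real v" "green m 0 v = 0"
    using v False by (auto simp: green_def max_def min_def of_nat_diff)
  then show ?thesis
    unfolding eq by simp
qed

section \<open>Taylor and Riemann sum estimates\<close>

lemma second_difference_approx:
  fixes f f' f'' :: "real \<Rightarrow> real"
  assumes f: "\<And>x. (f has_real_derivative f' x) (at x)"
    and f': "\<And>x. (f' has_real_derivative f'' x) (at x)"
    and lip: "\<And>x y. x \<in> {0..1} \<Longrightarrow> y \<in> {0..1} \<Longrightarrow> \<bar>f'' x - f'' y\<bar> \<le> L * \<bar>x - y\<bar>"
    and h: "h > 0" "x - h \<ge> 0" "x + h \<le> 1"
  shows "\<bar>f (x + h) - 2 * f x + f (x - h) - h\<^sup>2 * f'' x\<bar> \<le> L * h ^ 3"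
proof -
  define d where "d = (\<lambda>i::nat. if i = 0 then f else if i = 1 then f' else f'')"
  have d: "\<forall>m t. m < 2 \<and> x - h \<le> t \<and> t \<le> x + h \<longrightarrow> DERIV (d m) t :> d (Suc m) t"
    using f f' by (auto simp: d_def less_2_cases_iff)
  \<comment> \<open>Expanding on both sides of \<open>x\<close> cancels the first-order terms.
    Lipschitz continuity of \<open>f''\<close> then yields the third power of \<open>h\<close>, so
    that a multiple of 1/m remains after the later multiplication by m^2.\<close>
  have "\<exists>t>x. t < x + h \<and> f (x + h) = (\<Sum>m<2. (d m x / fact m) * (x + h - x) ^ m) + (d 2 t / fact 2) * (x + h - x) ^ 2"
    by (rule Taylor_up[OF _ _ d]) (use h in \<open>auto simp: d_def\<close>)
  then obtain s where s: "x < s" "s < x + h" "f (x + h) = f x + f' x * h + f'' s / 2 * h\<^sup>2"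
    by (auto simp: d_def numeral_2_eq_2)
  have "\<exists>t>x - h. t < x \<and> f (x - h) = (\<Sum>m<2. (d m x / fact m) * (x - h - x) ^ m) + (d 2 t / fact 2) * (x - h - x) ^ 2"
    by (rule Taylor_down[OF _ _ d]) (use h in \<open>auto simp: d_def\<close>)
  then obtain t where t: "x - h < t" "t < x" "f (x - h) = f x - f' x * h + f'' t / 2 * h\<^sup>2"
    by (auto simp: d_def numeral_2_eq_2)
  have L: "L \<ge> 0" using lip[of 0 1] by simp
  have "\<bar>f'' s - f'' x\<bar> \<le> L * \<bar>s - x\<bar>" "\<bar>f'' t - f'' x\<bar> \<le> L * \<bar>t - x\<bar>"
    using s t h by (intro lip; simp)+
  moreover have "L * \<bar>s - x\<bar> \<le> L * h" "L * \<bar>t - x\<bar> \<le> L * h"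
    using s t L by (auto intro!: mult_left_mono)
  ultimately have "\<bar>f'' s - f'' x\<bar> \<le> L * h" "\<bar>f'' t - f'' x\<bar> \<le> L * h"
    by (blast intro: order_trans)+
  then have "\<bar>(f'' s - f'' x) / 2 + (f'' t - f'' x) / 2\<bar> \<le> L * h" 
    by (simp add: abs_le_iff field_simps)
  then have "h\<^sup>2 * \<bar>(f'' s - f'' x) / 2 + (f'' t - f'' x) / 2\<bar> \<le> h\<^sup>2 * (L * h)"
    by (intro mult_left_mono) auto
  moreover have "f (x + h) - 2 * f x + f (x - h) - h\<^sup>2 * f'' x =
      h\<^sup>2 * ((f'' s - f'' x) / 2 + (f'' t - f'' x) / 2)"
    unfolding s t by (simp add: field_simps)
  ultimately show ?thesis
    by (simp add: abs_mult power2_eq_square power3_eq_cube mult_ac)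
qed

text \<open>The mean value theorem writes the increment of the primitive over each cell as a value
  of \<open>q\<close> divided by \<open>m\<close>; the Lipschitz bound compares it with the value at
  the left end.\<close>

lemma riemann_sum_approx:
  fixes q Q :: "real \<Rightarrow> real"
  assumes Q: "\<And>x. (Q has_real_derivative q x) (at x)"
    and lip: "\<And>x y. x \<in> {0..1} \<Longrightarrow> y \<in> {0..1} \<Longrightarrow> \<bar>q x - q y\<bar> \<le> L * \<bar>x - y\<bar>"
    and m: "m > 0"
  shows "\<bar>(\<Sum>v<m. q (real v / real m)) / real m - (Q 1 - Q 0)\<bar> \<le> L / real m"
proof -
  have L: "L \<ge> 0" using lip[of 0 1] by simp
  have step: "\<bar>q (real v / real m) / real m - (Q (real (Suc v) / real m) - Q (real v / real m))\<bar> \<le> L / real m / real m"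
    if "v < m" for v
  proof -
    have "\<exists>z>real v / real m. z < real (Suc v) / real m \<and>
        Q (real (Suc v) / real m) - Q (real v / real m) = (real (Suc v) / real m - real v / real m) * q z"
      using m by (intro MVT2 Q) (auto simp: divide_strict_right_mono)
    then obtain z where z: "real v / real m < z" "z < real (Suc v) / real m"
       "Q (real (Suc v) / real m) - Q (real v / real m) = (real (Suc v) / real m - real v / real m) * q z" by blast
    have eq: "real (Suc v) / real m - real v / real m = 1 / real m"
      by (simp add: diff_divide_distrib[symmetric])
    have le1: "real (Suc v) / real m \<le> 1" using that by simp
    have "0 \<le> real v / real m" by simp
    then have in01: "real v / real m \<in> {0..1}" "z \<in> {0..1}" using z(1,2) le1 unfolding atLeastAtMost_iff by linarith+
    have "\<bar>real v / real m - z\<bar> \<le> 1 / real m" using z(1,2) eq by linarith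
    then have "\<bar>q (real v / real m) - q z\<bar> \<le> L * (1 / real m)"
      using lip[OF in01] L by (meson mult_left_mono order_trans)
    then have "\<bar>q (real v / real m) - q z\<bar> / real m \<le> L * (1 / real m) / real m"
      by (rule divide_right_mono) simp
    then show ?thesis
      unfolding z(3) eq by (simp add: diff_divide_distrib[symmetric])
  qed
  have "Q 1 - Q 0 = (\<Sum>v<m. Q (real (Suc v) / real m) - Q (real v / real m))"
    using m by (subst sum_lessThan_telescope) simp
  then have "\<bar>(\<Sum>v<m. q (real v / real m)) / real m - (Q 1 - Q 0)\<bar> =
     \<bar>\<Sum>v<m. q (real v / real m) / real m - (Q (real (Suc v) / real m) - Q (real v / real m))\<bar>"
    by (simp add: sum_subtractf sum_divide_distrib)
  also have "\<dots> \<le> (\<Sum>v<m. L / real m / real m)"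
    by (intro order_trans[OF sum_abs] sum_mono step) simp
  finally show ?thesis using m by simp
qed

lemma lipschitz_of_derivative:
  fixes f f' :: "real \<Rightarrow> real"
  assumes f: "\<And>x. (f has_real_derivative f' x) (at x)" and f': "\<And>x. isCont f' x"
  obtains L where "\<And>x y. x \<in> {0..1} \<Longrightarrow> y \<in> {0..1} \<Longrightarrow> \<bar>f x - f y\<bar> \<le> L * \<bar>x - y\<bar>"
proof -
  have "\<exists>M. \<forall>x. 0 \<le> x \<and> x \<le> 1 \<longrightarrow> \<bar>f' x\<bar> \<le> M"
    using f' by (intro isCont_bounded) (auto intro: isCont_rabs)
  then obtain M where M: "\<And>x. 0 \<le> x \<Longrightarrow> x \<le> 1 \<Longrightarrow> \<bar>f' x\<bar> \<le> M" by blast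
  have less: "\<bar>f x - f y\<bar> \<le> M * \<bar>x - y\<bar>" if xy: "x < y" "0 \<le> x" "y \<le> 1" for x y
  proof -
    obtain z where z: "x < z" "z < y" "f y - f x = (y - x) * f' z"
      using MVT2[OF xy(1) f] by blast
    have "\<bar>f x - f y\<bar> = \<bar>f' z\<bar> * \<bar>x - y\<bar>"
      using z(3) xy(1) by (simp add: abs_minus_commute[of "f x"] abs_mult)
    also have "\<dots> \<le> M * \<bar>x - y\<bar>"
      using z xy by (intro mult_right_mono M) auto
    finally show ?thesis .
  qed
  show thesis
  proof
    fix x y :: real assume "x \<in> {0..1}" "y \<in> {0..1}"
    then show "\<bar>f x - f y\<bar> \<le> M * \<bar>x - y\<bar>"
      using less[of x y] less[of y x] by (cases x y rule: linorder_cases) (auto simp: abs_minus_commute)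
  qed
qed

text \<open>The iterates are described by derivatives and boundary values instead of integrals, so
  that coefficients of explicit series can be inserted directly. The start \<open>x ^ p\<close> is
  exempt from the boundary conditions.\<close>

locale dirichlet_sequence =
  fixes p :: nat and \<phi> \<phi>' :: "nat \<Rightarrow> real \<Rightarrow> real"
  assumes initial: "\<phi> 0 x = x ^ p"
    and deriv: "(\<phi> k has_real_derivative \<phi>' k x) (at x)"
    and deriv': "(\<phi>' (Suc k) has_real_derivative - \<phi> k x) (at x)"
    and cont': "isCont (\<phi>' k) x"
    and boundary: "\<phi> (Suc k) 0 = 0" "\<phi> (Suc k) 1 = 0"
begin

text \<open>On the grid, \<open>\<phi> (Suc k)\<close> solves the discrete equation up to a defect
  O(1/m). The Green sum has fewer than m terms of size at most m^2, so it enlarges the defect by at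
  most m^3, which is exactly the change of normalisation from \<open>k\<close> to
  \<open>Suc k\<close>.\<close>

lemma transfer_approx:
  "\<exists>C. \<forall>m>0. \<forall>v\<le>m.
     \<bar>transfer m (\<lambda>v. real v ^ p) k v / real m ^ (3 * k + p) - \<phi> k (real v / real m)\<bar> \<le> C / real m"
proof (induction k)
  case 0
  show ?case
    by (rule exI[of _ 0]) (simp add: initial power_divide)
next
  case (Suc k)
  let ?W = "\<lambda>m k v. transfer m (\<lambda>v. real v ^ p) k v / real m ^ (3 * k + p)"
  obtain C where C: "\<And>m v. m > 0 \<Longrightarrow> v \<le> m \<Longrightarrow> \<bar>?W m k v - \<phi> k (real v / real m)\<bar> \<le> C / real m"
    using Suc by blast
  obtain L where L: "\<And>x y. x \<in> {0..1} \<Longrightarrow> y \<in> {0..1} \<Longrightarrow> \<bar>\<phi> k x - \<phi> k y\<bar> \<le> L * \<bar>x - y\<bar>"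
    using lipschitz_of_derivative[OF deriv cont'] by blast
  have "\<bar>?W m (Suc k) v - \<phi> (Suc k) (real v / real m)\<bar> \<le> (C + L) / real m"
    if m: "m > 0" and v: "v \<le> m" for m v
  proof -
    define g where "g u = \<phi> (Suc k) (real u / real m)" for u
    let ?D = "\<lambda>u. g (u + 1) - 2 * g u + g (u - 1)"
    \<comment> \<open>The defect: the normalised \<open>transfer\<close> is close to
      \<open>\<phi> k\<close> by induction, and so is minus the scaled second difference of
      \<open>g\<close>.\<close>
    have close: "\<bar>?W m k u + (real m)\<^sup>2 * ?D u\<bar> \<le> (C + L) / real m" if u: "u \<in> {1..<m}" for u
    proof -
      have eq: "real (u + 1) / real m = real u / real m + 1 / real m"
        "real (u - 1) / real m = real u / real m - 1 / real m"
        using u by (auto simp: of_nat_diff add_divide_distrib diff_divide_distrib)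
      have "\<bar>?D u - (1 / real m)\<^sup>2 * - \<phi> k (real u / real m)\<bar> \<le> L * (1 / real m) ^ 3"
        unfolding g_def eq
      proof (rule second_difference_approx[OF deriv deriv'])
        show "\<bar>- \<phi> k x - - \<phi> k y\<bar> \<le> L * \<bar>x - y\<bar>" if "x \<in> {0..1}" "y \<in> {0..1}" for x y
          using L[OF that] by simp
      qed (use u m in \<open>auto simp: field_simps\<close>)
      then have "(real m)\<^sup>2 * \<bar>?D u - (1 / real m)\<^sup>2 * - \<phi> k (real u / real m)\<bar> \<le> (real m)\<^sup>2 * (L * (1 / real m) ^ 3)"
        by (rule mult_left_mono) simp
      also have "(real m)\<^sup>2 * (L * (1 / real m) ^ 3) = L / real m"
        using m by (simp add: field_simps power2_eq_square power3_eq_cube)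
      also have "(real m)\<^sup>2 * \<bar>?D u - (1 / real m)\<^sup>2 * - \<phi> k (real u / real m)\<bar> =
          \<bar>(real m)\<^sup>2 * (?D u - (1 / real m)\<^sup>2 * - \<phi> k (real u / real m))\<bar>"
        by (simp add: abs_mult)
      also have "(real m)\<^sup>2 * (?D u - (1 / real m)\<^sup>2 * - \<phi> k (real u / real m)) =
          (real m)\<^sup>2 * ?D u + \<phi> k (real u / real m)"
        using m by (simp add: distrib_left power_divide)
      finally have "\<bar>(real m)\<^sup>2 * ?D u + \<phi> k (real u / real m)\<bar> \<le> L / real m" .
      moreover have "\<bar>?W m k u - \<phi> k (real u / real m)\<bar> \<le> C / real m"
        using u m by (intro C) auto
      ultimately show ?thesis
        unfolding add_divide_distrib by linarith
    qed
    have g0: "g 0 = 0" "g m = 0"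
      using m by (simp_all add: g_def boundary)
    have green_bound: "\<bar>green m u v\<bar> \<le> (real m)\<^sup>2" if "u \<in> {1..<m}" for u
    proof -
      have "\<bar>green m u v\<bar> \<le> real m * real m"
        unfolding green_def abs_mult using that v by (intro mult_mono) auto
      then show ?thesis by (simp add: power2_eq_square)
    qed
    \<comment> \<open>The first summand produces the next iterate; the second is
      \<open>- m ^ 3 * g v\<close>, because \<open>g\<close> vanishes at both ends.\<close>
    have "(\<Sum>u\<in>{1..<m}. green m u v * (?W m k u + (real m)\<^sup>2 * ?D u)) =
      (\<Sum>u\<in>{1..<m}. green m u v * transfer m (\<lambda>v. real v ^ p) k u) / real m ^ (3 * k + p)
      + (real m)\<^sup>2 * (\<Sum>u\<in>{1..<m}. green m u v * ?D u)"
      by (simp add: distrib_left sum.distrib sum_distrib_left sum_divide_distrib mult_ac)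
    also have "\<dots> = (real m) ^ 3 * (?W m (Suc k) v - g v)"
      unfolding green_second_difference[OF v] g0 using m
      by (simp add: field_simps power_add power2_eq_square power3_eq_cube)
    finally have "(real m) ^ 3 * \<bar>?W m (Suc k) v - g v\<bar> =
       \<bar>\<Sum>u\<in>{1..<m}. green m u v * (?W m k u + (real m)\<^sup>2 * ?D u)\<bar>"
      by (simp add: abs_mult)
    also have "\<dots> \<le> (\<Sum>u\<in>{1..<m}. (real m)\<^sup>2 * ((C + L) / real m))"
    proof (rule order_trans[OF sum_abs sum_mono])
      fix u assume u: "u \<in> {1..<m}"
      show "\<bar>green m u v * (?W m k u + (real m)\<^sup>2 * ?D u)\<bar> \<le> (real m)\<^sup>2 * ((C + L) / real m)"
        unfolding abs_mult using green_bound[OF u] close[OF u] by (intro mult_mono) auto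
    qed
    also have "\<dots> = real (m - 1) * ((real m)\<^sup>2 * ((C + L) / real m))" by simp
    also have "\<dots> \<le> real m * ((real m)\<^sup>2 * ((C + L) / real m))"
    proof (rule mult_right_mono)
      have "0 \<le> C / real m" using C[OF m, of 0] by linarith
      moreover have "0 \<le> L" using L[of 0 1] by simp
      ultimately show "0 \<le> (real m)\<^sup>2 * ((C + L) / real m)"
        using m by (simp add: add_divide_distrib)
    qed simp
    also have "\<dots> = (real m) ^ 3 * ((C + L) / real m)"
      by (simp add: power2_eq_square power3_eq_cube)
    finally show ?thesis
      using m by (simp only: g_def mult_le_cancel_left_pos zero_less_power of_nat_0_less_iff)
  qed
  then show ?case by blast
qed

lemma transfer_sum_tendsto:
  assumes Q: "\<And>x. (Q has_real_derivative \<phi> k x * x ^ q) (at x)"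
  shows "(\<lambda>m. (\<Sum>v\<in>{1..<m}. transfer m (\<lambda>v. real v ^ p) k v * real v ^ q) / real m ^ (3 * k + p + q + 1))
           \<longlonglongrightarrow> Q 1 - Q 0"
proof -
  let ?W = "\<lambda>m v. transfer m (\<lambda>v. real v ^ p) k v / real m ^ (3 * k + p)"
  let ?q = "\<lambda>x. \<phi> k x * x ^ q"
  let ?T = "\<lambda>m. (\<Sum>v\<in>{1..<m}. transfer m (\<lambda>v. real v ^ p) k v * real v ^ q) / real m ^ (3 * k + p + q + 1)"
  obtain C where C: "\<And>m v. m > 0 \<Longrightarrow> v \<le> m \<Longrightarrow> \<bar>?W m v - \<phi> k (real v / real m)\<bar> \<le> C / real m"
    using transfer_approx[of k] by blast
  have d: "(?q has_real_derivative \<phi>' k x * x ^ q + (real q * x ^ (q - 1)) * \<phi> k x) (at x)" for x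
    using DERIV_mult[OF deriv[of k x] DERIV_pow[of q x]] by (simp add: numeral_eq_Suc)
  have c: "isCont (\<lambda>x. \<phi>' k x * x ^ q + (real q * x ^ (q - 1)) * \<phi> k x) x" for x
    by (intro isCont_add isCont_mult isCont_power continuous_ident continuous_const cont' DERIV_isCont[OF deriv])
  obtain L where L: "\<And>x y. x \<in> {0..1} \<Longrightarrow> y \<in> {0..1} \<Longrightarrow> \<bar>?q x - ?q y\<bar> \<le> L * \<bar>x - y\<bar>"
    using lipschitz_of_derivative[OF d c] by blast
  \<comment> \<open>Three errors: \<open>C\<close> for replacing the iterate by
    \<open>\<phi> k\<close>, \<open>L\<close> for the Riemann sum, and
    \<open>\<bar>?q 0\<bar>\<close> for the grid point 0, which is absent from the sum over
    \<open>{1..<m}\<close>.\<close>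
  have bound: "\<bar>?T m - (Q 1 - Q 0)\<bar> \<le> (C + L + \<bar>?q 0\<bar>) / real m" if m: "m > 0" for m
  proof -
    have riemann: "\<bar>(\<Sum>v<m. ?q (real v / real m)) / real m - (Q 1 - Q 0)\<bar> \<le> L / real m"
      by (rule riemann_sum_approx[OF Q L m])
    have "{..<m} = insert 0 {1..<m}" using m by auto
    then have split: "(\<Sum>v<m. ?q (real v / real m)) / real m =
        ?q 0 / real m + (\<Sum>v\<in>{1..<m}. ?q (real v / real m)) / real m"
      by (simp add: add_divide_distrib)
    have C0: "0 \<le> C / real m" using C[OF m, of 0] by linarith
    have T: "?T m = (\<Sum>v\<in>{1..<m}. ?W m v * (real v / real m) ^ q) / real m"
      by (simp add: sum_divide_distrib power_add power_divide mult_ac)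
    have "\<bar>?T m - (\<Sum>v\<in>{1..<m}. ?q (real v / real m)) / real m\<bar> =
        \<bar>\<Sum>v\<in>{1..<m}. (?W m v - \<phi> k (real v / real m)) * (real v / real m) ^ q\<bar> / real m"
      unfolding T diff_divide_distrib[symmetric] sum_subtractf[symmetric]
      by (simp add: left_diff_distrib)
    also have "\<dots> \<le> (\<Sum>v\<in>{1..<m}. C / real m) / real m"
    proof (intro divide_right_mono order_trans[OF sum_abs sum_mono])
      fix v assume v: "v \<in> {1..<m}"
      have "\<bar>(?W m v - \<phi> k (real v / real m)) * (real v / real m) ^ q\<bar> \<le> C / real m * 1"
        unfolding abs_mult using v m C0
        by (intro mult_mono C) (auto intro: power_le_one)
      then show "\<bar>(?W m v - \<phi> k (real v / real m)) * (real v / real m) ^ q\<bar> \<le> C / real m" by simp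
    qed simp
    also have "\<dots> = real (m - 1) * (C / real m) / real m" by simp
    also have "\<dots> \<le> real m * (C / real m) / real m"
      using C0 by (intro divide_right_mono mult_right_mono) auto
    also have "\<dots> = C / real m" using m by simp
    finally have "\<bar>?T m - (\<Sum>v\<in>{1..<m}. ?q (real v / real m)) / real m\<bar> \<le> C / real m" .
    moreover have "\<bar>?q 0 / real m\<bar> = \<bar>?q 0\<bar> / real m" by simp
    ultimately show ?thesis
      using riemann unfolding split add_divide_distrib by linarith
  qed
  have "(\<lambda>m. (C + L + \<bar>?q 0\<bar>) * inverse (real m)) \<longlonglongrightarrow> (C + L + \<bar>?q 0\<bar>) * 0"
    by (intro tendsto_mult_left lim_inverse_n)
  then have lim: "(\<lambda>m. (C + L + \<bar>?q 0\<bar>) / real m) \<longlonglongrightarrow> 0"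
    by (simp add: divide_inverse)
  have "(\<lambda>m. \<bar>?T m - (Q 1 - Q 0)\<bar>) \<longlonglongrightarrow> 0"
  proof (rule tendsto_sandwich[OF _ _ tendsto_const lim])
    show "\<forall>\<^sub>F m in sequentially. \<bar>?T m - (Q 1 - Q 0)\<bar> \<le> (C + L + \<bar>?q 0\<bar>) / real m"
      using eventually_gt_at_top[of 0] by eventually_elim (rule bound)
    show "\<forall>\<^sub>F m in sequentially. 0 \<le> \<bar>?T m - (Q 1 - Q 0)\<bar>"
      by (intro always_eventually allI abs_ge_zero)
  qed
  then have "(\<lambda>m. ?T m - (Q 1 - Q 0)) \<longlonglongrightarrow> 0"
    by (rule tendsto_rabs_zero_cancel)
  then show ?thesis
    by (simp only: LIM_zero_iff)
qed

text \<open>The next iterate supplies the primitive of \<open>\<phi> k\<close>, so the limit is a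
  difference of boundary slopes.\<close>

lemma transfer_sum_tendsto_0:
  "(\<lambda>m. (\<Sum>v\<in>{1..<m}. transfer m (\<lambda>v. real v ^ p) k v * real v ^ 0) / real m ^ (3 * k + p + 0 + 1))
     \<longlonglongrightarrow> \<phi>' (Suc k) 0 - \<phi>' (Suc k) 1"
  using transfer_sum_tendsto[of "\<lambda>x. - \<phi>' (Suc k) x" k 0] DERIV_minus[OF deriv'[of k]]
  by simp

lemma transfer_sum_tendsto_1:
  "(\<lambda>m. (\<Sum>v\<in>{1..<m}. transfer m (\<lambda>v. real v ^ p) k v * real v ^ 1) / real m ^ (3 * k + p + 1 + 1))
     \<longlonglongrightarrow> - \<phi>' (Suc k) 1"
proof -
  \<comment> \<open>This primitive comes from integrating \<open>- x * \<phi>''\<close> by parts;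
    the Dirichlet conditions leave only the slope at 1.\<close>
  have "((\<lambda>x. \<phi> (Suc k) x - x * \<phi>' (Suc k) x) has_real_derivative \<phi> k x * x ^ 1) (at x)" for x
    by (rule derivative_eq_intros deriv deriv' refl | simp)+
  from transfer_sum_tendsto[OF this] show ?thesis
    by (simp add: boundary)
qed

end

section \<open>Fillings of three antidiagonals\<close>

definition young_order :: "(nat \<times> nat) set \<Rightarrow> ((nat \<times> nat) \<times> nat \<times> nat) set" where
  "young_order D = {((i, j), (i', j')). (i, j) \<in> D \<and> (i', j') \<in> D \<and>
     (i = i' \<and> j < j' \<or> j = j' \<and> i < i')}"

lemma young_order_subset: "young_order D \<subseteq> D \<times> D"
  by (auto simp: young_order_def)

lemma irrefl_young_order: "irrefl (young_order D)"
  by (auto simp: young_order_def irrefl_def)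

lemma num_syt_eq: "num_syt D = card (strict_bijections D (young_order D) {1..card D})"
proof -
  have "standard_young_tableaux D = strict_bijections D (young_order D) {1..card D}"
    unfolding standard_young_tableaux_def strict_bijections_def young_order_def
    by (intro Collect_cong) auto
  then show ?thesis by (simp add: num_syt_def)
qed

text \<open>
  The middle antidiagonal of the strip has \<open>n\<close> boxes. The flag \<open>r\<close> (respectively \<open>q\<close>) adds a box of
  the lower antidiagonal that is adjacent only to the first (respectively last) of them.
\<close>

definition strip :: "nat \<Rightarrow> nat \<Rightarrow> nat \<Rightarrow> (nat \<times> nat) set" where
  "strip r q n = {(i, j). i < n + r \<and> j < n + q \<and> n + r + q \<le> i + j + 2 \<and> i + j \<le> n + r + q}"

lemma finite_strip: "finite (strip r q n)"
  by (rule finite_subset[of _ "{..<n + r} \<times> {..<n + q}"]) (auto simp: strip_def)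

lemma mem_skew_shape:
  "(i, j) \<in> skew_shape la mu \<longleftrightarrow>
     i < length la \<and> j < la ! i \<and> \<not> (i < length mu \<and> j < mu ! i)"
  by (auto simp: skew_shape_def young_diagram_def)

text \<open>Row \<open>i\<close> occupies the columns from max(0, n - 2 - i) up to min(n - 1, n -
  i), which are the boxes with n - 2 \<le> i + j \<le> n inside the square.\<close>

lemma sigma_first_eq_strip:
  assumes "n \<ge> 1"
  shows "sigma (3 * n - 2) = strip 0 0 n"
proof -
  consider "n = 1" | "n = 2" | "n \<ge> 3" using assms by linarith
  then show ?thesis
  proof cases
    case 3
    have "sigma (3 * n - 2) = skew_shape ([n, n] @ rev [2..<n]) (rev [1..<n - 1] @ [0, 0])"
    proof -
      have "(3 * n - 2 + 2) div 3 = n" "3 * n - 2 \<noteq> 1" "3 * n - 2 \<noteq> 2" "3 * n - 2 \<noteq> 4" "3 * n - 2 \<noteq> 5"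
        using 3 by auto
      then show ?thesis
        unfolding sigma_def Let_def using 3 by (simp only: if_False if_True simp_thms)
    qed
    also have "\<dots> = strip 0 0 n"
      using 3 by (auto simp: set_eq_iff mem_skew_shape strip_def nth_append nth_Cons' rev_nth split: if_splits)
    finally show ?thesis .
  qed (auto simp: sigma_def set_eq_iff mem_skew_shape strip_def nth_Cons' less_Suc_eq numeral_2_eq_2)
qed

lemma sigma_second_eq_strip:
  assumes "n \<ge> 1"
  shows "sigma (3 * n - 1) = strip 1 0 n"
proof -
  consider "n = 1" | "n = 2" | "n \<ge> 3" using assms by linarith
  then show ?thesis
  proof cases
    case 3
    have "sigma (3 * n - 1) = skew_shape ([n, n, n] @ rev [2..<n]) (rev [1..<n] @ [0, 0])"
    proof -
      have "(3 * n - 1 + 2) div 3 = n" "3 * n - 1 \<noteq> 1" "3 * n - 1 \<noteq> 2" "3 * n - 1 \<noteq> 4" "3 * n - 1 \<noteq> 5"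
        "3 * n - 1 \<noteq> 3 * n - 2"
        using 3 by auto
      then show ?thesis
        unfolding sigma_def Let_def using 3 by (simp only: if_False if_True simp_thms)
    qed
    also have "\<dots> = strip 1 0 n"
      using 3 by (auto simp: set_eq_iff mem_skew_shape strip_def nth_append nth_Cons' rev_nth split: if_splits)
    finally show ?thesis .
  qed (auto simp: sigma_def set_eq_iff mem_skew_shape strip_def nth_Cons' less_Suc_eq numeral_2_eq_2)
qed

lemma tau_eq_strip:
  assumes "n \<ge> 1"
  shows "tau (3 * n) = strip 1 1 n"
proof -
  consider "n = 1" | "n \<ge> 2" using assms by linarith
  then show ?thesis
  proof cases
    case 2
    then have "tau (3 * n) =
        skew_shape ([n + 1, n + 1, n + 1] @ rev [3..<n + 1]) (rev [1..<n + 1] @ [0])"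
      by (simp add: tau_def Let_def)
    also have "\<dots> = strip 1 1 n"
      using 2 by (auto simp: set_eq_iff mem_skew_shape strip_def nth_append nth_Cons' rev_nth split: if_splits)
    finally show ?thesis .
  qed (auto simp: tau_def set_eq_iff mem_skew_shape strip_def nth_Cons' less_Suc_eq numeral_2_eq_2)
qed

text \<open>Middle box \<open>a\<close> is \<open>(a + r, k - a + q)\<close>. The boxes
  \<open>(a + r + 1, k - a + q)\<close> and \<open>(a + r, k - a - 1 + q)\<close> are the two common
  neighbours of middle boxes \<open>a\<close> and \<open>a + 1\<close>. The last two images are the
  optional end boxes, empty or a single box.\<close>

lemma strip_decomposition:
  assumes "r \<le> 1" "q \<le> 1"
  shows "strip r q (Suc k) =
    ((\<lambda>a. (a + r, k - a + q)) ` {..k} \<union> (\<lambda>a. (a + r + 1, k - a + q)) ` {..<k}) \<union>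
    (((\<lambda>a. (a + r, k - a - 1 + q)) ` {..<k} \<union> (\<lambda>a. (a, k + q)) ` {..<r}) \<union> (\<lambda>a. (k + r, a)) ` {..<q})"
  (is "_ = ?R")
proof (rule set_eqI)
  fix p :: "nat \<times> nat"
  obtain i j where p: "p = (i, j)" by (cases p)
  show "p \<in> strip r q (Suc k) \<longleftrightarrow> p \<in> ?R"
  proof
    assume "p \<in> strip r q (Suc k)"
    then have *: "i < Suc k + r" "j < Suc k + q" "k + r + q \<le> i + j + 1" "i + j \<le> Suc k + r + q"
      by (auto simp: p strip_def)
    then consider "i + j = k + r + q" | "i + j = k + r + q + 1"
      | "i + j + 1 = k + r + q" "r \<le> i" "i < k + r" | "i + j + 1 = k + r + q" "i < r"
      | "i + j + 1 = k + r + q" "r \<le> i" "i = k + r" by linarith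
    then show "p \<in> ?R"
    proof cases
      case 1
      then have "p \<in> (\<lambda>a. (a + r, k - a + q)) ` {..k}"
        using * by (intro image_eqI[of _ _ "i - r"]) (auto simp: p)
      then show ?thesis by blast
    next
      case 2
      then have "p \<in> (\<lambda>a. (a + r + 1, k - a + q)) ` {..<k}"
        using * by (intro image_eqI[of _ _ "i - r - 1"]) (auto simp: p)
      then show ?thesis by blast
    next
      case 3
      then have "p \<in> (\<lambda>a. (a + r, k - a - 1 + q)) ` {..<k}"
        using * by (intro image_eqI[of _ _ "i - r"]) (auto simp: p)
      then show ?thesis by blast
    next
      case 4
      then have "p \<in> (\<lambda>a. (a, k + q)) ` {..<r}"
        using * assms by (intro image_eqI[of _ _ i]) (auto simp: p)
      then show ?thesis by blast
    next
      case 5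
      then have "p \<in> (\<lambda>a. (k + r, a)) ` {..<q}"
        using * assms by (intro image_eqI[of _ _ j]) (auto simp: p)
      then show ?thesis by blast
    qed
  next
    assume "p \<in> ?R"
    then show "p \<in> strip r q (Suc k)"
      using assms unfolding strip_def p by fastforce
  qed
qed

text \<open>A general factor \<open>F\<close> serves both the number of fillings and the number of
  boxes; the flags act as exponents that switch the end boxes on or off.\<close>

lemma prod_strip:
  assumes rq: "r \<le> 1" "q \<le> 1"
  shows "(\<Prod>p\<in>strip r q (Suc k). F p) =
    (\<Prod>a\<le>k. F (a + r, k - a + q)) * (\<Prod>a<k. F (a + r + 1, k - a + q)) *
    ((\<Prod>a<k. F (a + r, k - a - 1 + q)) * (F (0, k + q)) ^ r * (F (k + r, 0)) ^ q)"
proof -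
  have inj: "inj_on (\<lambda>a. (a + r, k - a + q)) {..k}" "inj_on (\<lambda>a. (a + r + 1, k - a + q)) {..<k}"
     "inj_on (\<lambda>a. (a + r, k - a - 1 + q)) {..<k}" "inj_on (\<lambda>a. (a, k + q)) {..<r}"
     "inj_on (\<lambda>a. (k + r, a)) {..<q}"
    by (auto simp: inj_on_def)
  have "(\<Prod>a<r. F (a, k + q)) = (F (0, k + q)) ^ r" "(\<Prod>a<q. F (k + r, a)) = (F (k + r, 0)) ^ q"
    using rq by (auto simp: le_Suc_eq)
  then show ?thesis
    unfolding strip_decomposition[OF rq]
    apply (subst prod.union_disjoint; (use rq in force)?)+
    apply (simp only: prod.reindex[OF inj(1)] prod.reindex[OF inj(2)] prod.reindex[OF inj(3)] prod.reindex[OF inj(4)] prod.reindex[OF inj(5)] o_def)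
    done
qed

lemma card_strip:
  assumes "r \<le> 1" "q \<le> 1"
  shows "card (strip r q (Suc k)) = 3 * k + r + q + 1"
proof -
  \<comment> \<open>The constant factor 2 turns the product formula into a count in the
    exponent.\<close>
  have "(2::nat) ^ card (strip r q (Suc k)) = (\<Prod>p\<in>strip r q (Suc k). 2)"
    by simp
  also have "\<dots> = 2 ^ (3 * k + r + q + 1)"
    unfolding prod_strip[OF assms] by (simp flip: power_add power_Suc add: algebra_simps)
  finally show ?thesis by (simp only: power_inject_exp one_less_numeral_iff semiring_norm)
qed

text \<open>
  The boxes of the strip lie on three antidiagonals; \<open>y a\<close> is the entry of box \<open>a\<close> of the
  middle one. For fixed \<open>y\<close> the other entries vary independently, in the following ranges.
\<close>

definition strip_range :: "nat \<Rightarrow> nat \<Rightarrow> nat \<Rightarrow> nat set \<Rightarrow> (nat \<Rightarrow> nat) \<Rightarrow> nat \<times> nat \<Rightarrow> nat set" where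
  "strip_range r q k V y = (\<lambda>(i, j).
     if i + j = k + r + q then {y (i - r)}
     else if i + j = k + r + q + 1 then {v \<in> V. y (i - r - 1) \<le> v \<and> y (i - r) \<le> v}
     else {v \<in> V. (r \<le> i \<longrightarrow> v \<le> y (i - r)) \<and> (i + 1 - r \<le> k \<longrightarrow> v \<le> y (i + 1 - r))})"

text \<open>Two neighbouring boxes lie on consecutive antidiagonals, so one of them is a middle box.
  Once \<open>y\<close> is fixed, the constraints therefore decouple into one range per box, and
  comparisons of more distant boxes follow along the row or column.\<close>

lemma weak_maps_fiber:
  assumes rq: "r \<le> 1" "q \<le> 1" and y: "y \<in> {..k} \<rightarrow>\<^sub>E V"
  shows "{f \<in> weak_maps (strip r q (Suc k)) (young_order (strip r q (Suc k))) V.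
            restrict (\<lambda>a. f (a + r, k - a + q)) {..k} = y} =
         PiE (strip r q (Suc k)) (strip_range r q k V y)"
    (is "?L = ?R")
proof (intro equalityI subsetI)
  let ?S = "strip r q (Suc k)"
  fix f assume f: "f \<in> ?L"
  then have fV: "f \<in> ?S \<rightarrow>\<^sub>E V"
    by (auto simp: weak_maps_def)
  have le: "f (i, j) \<le> f (i', j')" if "((i, j), (i', j')) \<in> young_order ?S" for i j i' j'
    using f that by (auto simp: weak_maps_def)
  have yf: "y a = f (a + r, k - a + q)" if "a \<le> k" for a
    using f that by auto
  have "f (i, j) \<in> strip_range r q k V y (i, j)" if p: "(i, j) \<in> ?S" for i j
  proof -
    have *: "i < Suc k + r" "j < Suc k + q" "k + r + q \<le> i + j + 1" "i + j \<le> Suc k + r + q"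
      using p by (auto simp: strip_def)
    have V: "f (i, j) \<in> V" using fV p by auto
    consider "i + j = k + r + q" | "i + j = k + r + q + 1" | "i + j + 1 = k + r + q"
      using * by linarith
    then show ?thesis
    proof cases
      case 1
      have "y (i - r) = f (i - r + r, k - (i - r) + q)"
        using 1 * by (intro yf) auto
      moreover have "i - r + r = i" "k - (i - r) + q = j" using 1 * by auto
      ultimately have "y (i - r) = f (i, j)" by (simp only:)
      then show ?thesis using 1 by (simp add: strip_range_def)
    next
      case 2
      have "i - r - 1 \<le> k" "i - r \<le> k"
        using 2 * by auto
      then have "y (i - r - 1) = f (i - r - 1 + r, k - (i - r - 1) + q)" "y (i - r) = f (i - r + r, k - (i - r) + q)"
        using yf by blast+
      moreover have "i - r - 1 + r = i - 1" "k - (i - r - 1) + q = j" "i - r + r = i" "k - (i - r) + q = j - 1"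
        using 2 * by auto
      ultimately have "y (i - r - 1) = f (i - 1, j)" "y (i - r) = f (i, j - 1)" by (simp_all only:)
      moreover have "f (i - 1, j) \<le> f (i, j)" "f (i, j - 1) \<le> f (i, j)"
        using 2 * by (auto intro!: le simp: young_order_def strip_def)
      ultimately show ?thesis using 2 V by (simp add: strip_range_def)
    next
      case 3
      have "f (i, j) \<le> y (i - r)" if "r \<le> i"
      proof -
        have "y (i - r) = f (i - r + r, k - (i - r) + q)"
          using 3 * that by (intro yf) auto
        moreover have "i - r + r = i" "k - (i - r) + q = j + 1" using 3 * that by auto
        ultimately have "y (i - r) = f (i, j + 1)" by (simp only:)
        moreover have "f (i, j) \<le> f (i, j + 1)"
          using 3 * that by (auto intro!: le simp: young_order_def strip_def)
        ultimately show ?thesis by simp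
      qed
      moreover have "f (i, j) \<le> y (i + 1 - r)" if "i + 1 - r \<le> k"
      proof -
        have "y (i + 1 - r) = f (i + 1 - r + r, k - (i + 1 - r) + q)"
          using that by (rule yf)
        moreover have "i + 1 - r + r = i + 1" "k - (i + 1 - r) + q = j" using 3 * that rq by auto
        ultimately have "y (i + 1 - r) = f (i + 1, j)" by (simp only:)
        moreover have "f (i, j) \<le> f (i + 1, j)"
          using 3 * that rq by (auto intro!: le simp: young_order_def strip_def)
        ultimately show ?thesis by simp
      qed
      ultimately show ?thesis using 3 V by (simp add: strip_range_def)
    qed
  qed
  then show "f \<in> ?R"
    using fV by (auto simp: PiE_def Pi_def)
next
  let ?S = "strip r q (Suc k)"
  fix f assume f: "f \<in> ?R"
  then have fI: "f (i, j) \<in> strip_range r q k V y (i, j)" if "(i, j) \<in> ?S" for i j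
    using that by (rule PiE_mem)
  have mid: "f (i, j) = y (i - r)" if "i + j = k + r + q" "(i, j) \<in> ?S" for i j
    using fI[OF that(2)] that(1) by (simp add: strip_range_def)
  have "f (i, j) \<in> V" if "(i, j) \<in> ?S" for i j
  proof (cases "i + j = k + r + q")
    case True
    then have "i - r \<le> k" using that by (auto simp: strip_def)
    then show ?thesis using mid[OF True that] y by auto
  next
    case False
    then show ?thesis using fI[OF that] by (auto simp: strip_range_def split: if_splits)
  qed
  then have fV: "f \<in> ?S \<rightarrow>\<^sub>E V"
    using f by (auto simp: PiE_def Pi_def)
  have right: "f (i, j) \<le> f (i, Suc j)" if p: "(i, j) \<in> ?S" "(i, Suc j) \<in> ?S" for i j
  proof -
    have "k + r + q \<le> i + j + 1" "i + j \<le> k + r + q"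
      using p by (auto simp: strip_def)
    then consider "i + j = k + r + q" | "i + j + 1 = k + r + q"
      by linarith
    then show ?thesis
    proof cases
      case 1
      then show ?thesis using mid[OF 1 p(1)] fI[OF p(2)] by (simp add: strip_range_def)
    next
      case 2
      \<comment> \<open>A right neighbour inside the strip rules out the extra box
        \<open>(0, k + q)\<close>, for which \<open>i - r\<close> would be truncated.\<close>
      then have "r \<le> i" using p by (auto simp: strip_def)
      then show ?thesis using mid[OF _ p(2)] fI[OF p(1)] 2 by (simp add: strip_range_def)
    qed
  qed
  have down: "f (i, j) \<le> f (Suc i, j)" if p: "(i, j) \<in> ?S" "(Suc i, j) \<in> ?S" for i j
  proof -
    have "k + r + q \<le> i + j + 1" "i + j \<le> k + r + q"
      using p by (auto simp: strip_def)
    then consider "i + j = k + r + q" | "i + j + 1 = k + r + q"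
      by linarith
    then show ?thesis
    proof cases
      case 1
      then have "Suc i - r - 1 = i - r" by simp
      then show ?thesis using mid[OF 1 p(1)] fI[OF p(2)] 1 by (simp add: strip_range_def)
    next
      case 2
      then have "i + 1 - r \<le> k" using p by (auto simp: strip_def)
      then show ?thesis using mid[OF _ p(2)] fI[OF p(1)] 2 by (simp add: strip_range_def)
    qed
  qed
  have row: "f (i, j) \<le> f (i, j + d)" if "(i, j) \<in> ?S" "(i, j + d) \<in> ?S" for i j d
    using that
  proof (induction d)
    case (Suc d)
    then have "(i, j + d) \<in> ?S" by (auto simp: strip_def)
    with Suc right[of i "j + d"] show ?case by simp
  qed simp
  have column: "f (i, j) \<le> f (i + d, j)" if "(i, j) \<in> ?S" "(i + d, j) \<in> ?S" for i j d
    using that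
  proof (induction d)
    case (Suc d)
    then have "(i + d, j) \<in> ?S" by (auto simp: strip_def)
    with Suc down[of "i + d" j] show ?case by simp
  qed simp
  have "f (i, j) \<le> f (i', j')" if "((i, j), (i', j')) \<in> young_order ?S" for i j i' j'
    using that row[of i j "j' - j"] column[of i j "i' - i"] by (auto simp: young_order_def)
  then have "f \<in> weak_maps ?S (young_order ?S) V"
    using fV by (auto simp: weak_maps_def)
  moreover have "restrict (\<lambda>a. f (a + r, k - a + q)) {..k} = y"
  proof (rule extensionalityI[of _ "{..k}"])
    show "y \<in> extensional {..k}" using y by (auto simp: PiE_def)
    fix a assume "a \<in> {..k}"
    then show "restrict (\<lambda>a. f (a + r, k - a + q)) {..k} a = y a"
      using mid[of "a + r" "k - a + q"] by (auto simp: strip_def)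
  qed simp
  ultimately show "f \<in> ?L" by simp
qed

text \<open>Fillings are grouped by their middle antidiagonal. With values in \<open>{1..<m}\<close>
  the ranges of the outer boxes are \<open>{1..min u v}\<close> and \<open>{max u v..<m}\<close>, so
  the count equals the Green product exactly, without an error term.\<close>

lemma card_weak_maps_strip:
  assumes rq: "r \<le> 1" "q \<le> 1"
  shows "real (card (weak_maps (strip r q (Suc k)) (young_order (strip r q (Suc k))) {1..<m})) =
     (\<Sum>v\<in>{1..<m}. transfer m (\<lambda>v. real v ^ r) k v * real v ^ q)"
proof -
  let ?S = "strip r q (Suc k)" and ?V = "{1..<m}"
  let ?W = "weak_maps ?S (young_order ?S) ?V" and ?g = "\<lambda>f. restrict (\<lambda>a. f (a + r, k - a + q)) {..k}"
  have fin: "finite ?W"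
    by (rule finite_subset[of _ "?S \<rightarrow>\<^sub>E ?V"]) (auto simp: weak_maps_def intro: finite_PiE finite_strip)
  have mid_mem: "(a + r, k - a + q) \<in> ?S" if "a \<le> k" for a
    using that by (auto simp: strip_def)
  have "?g ` ?W \<subseteq> {..k} \<rightarrow>\<^sub>E ?V"
  proof (rule image_subsetI)
    fix f assume "f \<in> ?W"
    then have "f \<in> ?S \<rightarrow>\<^sub>E ?V" by (simp add: weak_maps_def)
    then have "f (a + r, k - a + q) \<in> ?V" if "a \<le> k" for a
      using mid_mem[OF that] by (rule PiE_mem)
    then show "?g f \<in> {..k} \<rightarrow>\<^sub>E ?V" by simp
  qed
  then have "(\<Sum>y\<in>{..k} \<rightarrow>\<^sub>E ?V. \<Sum>f\<in>{f \<in> ?W. ?g f = y}. 1) = (\<Sum>f\<in>?W. 1::nat)"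
    by (intro sum.group fin) (auto intro: finite_PiE)
  then have "card ?W = (\<Sum>y\<in>{..k} \<rightarrow>\<^sub>E ?V. card {f \<in> ?W. ?g f = y})"
    by simp
  also have "\<dots> = (\<Sum>y\<in>{..k} \<rightarrow>\<^sub>E ?V. \<Prod>p\<in>?S. card (strip_range r q k ?V y p))"
    by (intro sum.cong refl) (simp only: weak_maps_fiber[OF rq] card_PiE[OF finite_strip])
  finally have "real (card ?W) = (\<Sum>y\<in>{..k} \<rightarrow>\<^sub>E ?V. real (\<Prod>p\<in>?S. card (strip_range r q k ?V y p)))"
    by simp
  also have "\<dots> = (\<Sum>y\<in>{..k} \<rightarrow>\<^sub>E ?V.
      real (y 0) ^ r * (\<Prod>a<k. green m (y a) (y (Suc a))) * real (y k) ^ q)"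
  proof (intro sum.cong refl)
    fix y assume y: "y \<in> {..k} \<rightarrow>\<^sub>E ?V"
    let ?I = "strip_range r q k ?V y"
    have yV: "1 \<le> y a" "y a < m" if "a \<le> k" for a
      using y that by (auto simp: PiE_def Pi_def)
    have mid: "card (?I (a + r, k - a + q)) = 1" if "a \<le> k" for a
      using that by (simp add: strip_range_def)
    have top: "card (?I (a + r + 1, k - a + q)) = m - max (y a) (y (Suc a))" if "a < k" for a
    proof -
      have "?I (a + r + 1, k - a + q) = {max (y a) (y (Suc a))..<m}"
        using that yV[of a] by (auto simp: strip_range_def)
      then show ?thesis by simp
    qed
    have bot: "card (?I (a + r, k - a - 1 + q)) = min (y a) (y (Suc a))" if "a < k" for a
    proof -
      have "?I (a + r, k - a - 1 + q) = {1..min (y a) (y (Suc a))}"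
        using that yV[of a] by (auto simp: strip_range_def)
      then show ?thesis by simp
    qed
    \<comment> \<open>For \<open>r = 0\<close> the box \<open>(0, k + q)\<close> is the first middle
      box, and the exponent turns its factor into 1. The box at the other end behaves in the same
      way.\<close>
    have left: "card (?I (0, k + q)) ^ r = y 0 ^ r"
    proof (cases "r = 1")
      case True
      then have "?I (0, k + q) = {1..y 0}"
        using yV[of 0] by (auto simp: strip_range_def)
      then show ?thesis by simp
    qed (use rq in \<open>simp add: le_Suc_eq\<close>)
    have right: "card (?I (k + r, 0)) ^ q = y k ^ q"
    proof (cases "q = 1")
      case True
      then have "?I (k + r, 0) = {1..y k}"
        using yV[of k] by (auto simp: strip_range_def)
      then show ?thesis by simp
    qed (use rq in \<open>simp add: le_Suc_eq\<close>)
    have green: "real (m - max (y a) (y (Suc a))) * real (min (y a) (y (Suc a))) = green m (y a) (y (Suc a))"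
      if "a < k" for a
      using that yV[of a] yV[of "Suc a"] by (simp add: green_def of_nat_diff)
    have "(\<Prod>p\<in>?S. card (?I p)) =
      (\<Prod>a<k. m - max (y a) (y (Suc a))) * ((\<Prod>a<k. min (y a) (y (Suc a))) * y 0 ^ r * y k ^ q)"
      unfolding prod_strip[OF rq] left right using mid top bot by simp
    then have "real (\<Prod>p\<in>?S. card (?I p)) =
      (\<Prod>a<k. real (m - max (y a) (y (Suc a))) * real (min (y a) (y (Suc a)))) * real (y 0) ^ r * real (y k) ^ q"
      by (simp only: of_nat_mult of_nat_prod of_nat_power prod.distrib mult_ac)
    then show "real (\<Prod>p\<in>?S. card (?I p)) =
      real (y 0) ^ r * (\<Prod>a<k. green m (y a) (y (Suc a))) * real (y k) ^ q"
      using green by (simp add: mult_ac)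
  qed
  also have "\<dots> = (\<Sum>v\<in>?V. transfer m (\<lambda>v. real v ^ r) k v * real v ^ q)"
    by (rule sum_chain_eq_transfer)
  finally show ?thesis .
qed

section \<open>Generating functions\<close>

unbundle fps_syntax

text \<open>The series variable is t and x is a real parameter: \<open>fps_sin (x + c)\<close> is
  the series of sin ((x + c) t), whose coefficients are polynomials in x, and d/dx brings out a
  factor t.\<close>

lemma fps_sin_nth_has_derivative:
  "((\<lambda>x. fps_sin (x + c) $ n) has_real_derivative (fps_X * fps_cos (x + c)) $ n) (at x)"
proof (cases "even n")
  case True
  then show ?thesis
    by (cases n) (auto simp: fps_sin_def fps_cos_def)
next
  case False
  then obtain k where n: "n = Suc (2 * k)" by (auto elim: oddE)
  have "((\<lambda>x. (-1) ^ k * (x + c) ^ Suc (2 * k) / fact (Suc (2 * k))) has_real_derivative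
      (-1) ^ k * (real (Suc (2 * k)) * (x + c) ^ (2 * k)) / fact (Suc (2 * k))) (at x)"
    by (rule derivative_eq_intros refl | simp)+
  also have "(-1) ^ k * (real (Suc (2 * k)) * (x + c) ^ (2 * k)) / fact (Suc (2 * k)) = (-1) ^ k * (x + c) ^ (2 * k) / fact (2 * k)"
    by (simp only: fact_Suc) (simp del: of_nat_Suc)
  finally show ?thesis
    by (simp add: n fps_sin_def fps_cos_def del: fact_Suc power_Suc)
qed

lemma fps_cos_nth_has_derivative:
  "((\<lambda>x. fps_cos (x + c) $ n) has_real_derivative (- fps_X * fps_sin (x + c)) $ n) (at x)"
proof (cases "even n")
  case False
  then show ?thesis
    by (cases n) (auto simp: fps_sin_def fps_cos_def)
next
  case True
  show ?thesis
  proof (cases "n = 0")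
    case False
    obtain j where j: "n = 2 * j" using True by (rule evenE)
    with False obtain k where "j = Suc k" using not0_implies_Suc[of j] by auto
    with j have n: "n = Suc (Suc (2 * k))" by simp
    have "((\<lambda>x. (-1) ^ Suc k * (x + c) ^ n / fact n) has_real_derivative
        (-1) ^ Suc k * (real n * (x + c) ^ Suc (2 * k)) / fact n) (at x)"
      by (rule derivative_eq_intros refl | simp add: n)+
    also have "(-1) ^ Suc k * (real n * (x + c) ^ Suc (2 * k)) / fact n = (-1) ^ Suc k * (x + c) ^ Suc (2 * k) / fact (Suc (2 * k))"
      unfolding n by (simp only: fact_Suc[of "Suc (2 * k)"]) (simp del: of_nat_Suc fact_Suc)
    finally show ?thesis
      by (simp add: n fps_sin_def fps_cos_def del: fact_Suc power_Suc) simp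
  qed simp
qed

lemma fps_mult_nth_has_derivative:
  fixes S :: "real fps"
  assumes "\<And>n. ((\<lambda>x. F x $ n) has_real_derivative F' $ n) (at x)"
  shows "((\<lambda>x. (F x * S) $ n) has_real_derivative (F' * S) $ n) (at x)"
  unfolding fps_mult_nth by (rule DERIV_sum DERIV_cmult_right assms)+

lemma fps_sin_mult_nth_has_derivative:
  "((\<lambda>x. (fps_sin (x + c) * S) $ n) has_real_derivative (fps_X * (fps_cos (x + c) * S)) $ n) (at x)"
  using fps_mult_nth_has_derivative[OF fps_sin_nth_has_derivative] by (simp only: mult.assoc)

lemma fps_cos_mult_nth_has_derivative:
  "((\<lambda>x. (fps_cos (x + c) * S) $ n) has_real_derivative - ((fps_X * (fps_sin (x + c) * S)) $ n)) (at x)"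
  using fps_mult_nth_has_derivative[OF fps_cos_nth_has_derivative, of c S n x] by (simp add: mult.assoc)

abbreviation secant_half :: "real fps" where
  "secant_half \<equiv> inverse (fps_cos (1 / 2))"

lemma fps_sin_neg: "fps_sin (- c) = - fps_sin (c :: real)"
  by (rule fps_ext) (auto simp: fps_sin_def elim!: oddE)

lemma fps_cos_neg: "fps_cos (- c) = fps_cos (c :: real)"
  by (rule fps_ext) (auto simp: fps_cos_def)

lemma fps_tan_half: "fps_sin (1 / 2) * secant_half = fps_tan (1 / 2 :: real)"
  by (simp add: fps_tan_def fps_divide_unit)

lemma cos_half_secant_half: "fps_cos (1 / 2) * secant_half = 1"
  by (simp add: inverse_mult_eq_1')

text \<open>The series t / sin t. The sine has constant term 0, so the shift divides it by t before
  the inversion.\<close>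

definition x_csc :: "real fps" where
  "x_csc = inverse (fps_shift 1 (fps_sin 1))"

definition x_cot :: "real fps" where
  "x_cot = fps_cos 1 * x_csc"

lemma fps_sin_1_eq: "fps_sin 1 = fps_X * fps_shift 1 (fps_sin (1 :: real))"
  by (rule fps_ext) (auto simp: fps_X_mult_nth)

lemma sin_x_csc: "fps_sin 1 * x_csc = fps_X"
proof -
  have "fps_shift 1 (fps_sin 1) * x_csc = 1"
    unfolding x_csc_def by (rule inverse_mult_eq_1') simp
  then show ?thesis
    by (subst fps_sin_1_eq) (simp only: mult.assoc mult_1_right)
qed

text \<open>Two derivatives in x multiply the series by -t^2, which lowers the coefficient index by
  two. At x = 0 and x = 1 the series is the constant 1, so all later coefficients vanish
  there.\<close>

interpretation sec_half: dirichlet_sequence 0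
  "\<lambda>k x. (fps_cos (x - 1 / 2) * secant_half) $ (2 * k)"
  "\<lambda>k x. - ((fps_X * (fps_sin (x - 1 / 2) * secant_half)) $ (2 * k))"
proof
  note d = fps_cos_mult_nth_has_derivative[where c = "- 1 / 2"]
    fps_sin_mult_nth_has_derivative[where c = "- 1 / 2"]
  fix k :: nat and x :: real
  show "(fps_cos (x - 1 / 2) * secant_half) $ (2 * 0) = x ^ 0" by simp
  show "((\<lambda>x. (fps_cos (x - 1 / 2) * secant_half) $ (2 * k)) has_real_derivative
      - ((fps_X * (fps_sin (x - 1 / 2) * secant_half)) $ (2 * k))) (at x)"
    using d(1)[of secant_half "2 * k" x] by simp
  have sin: "((\<lambda>x. (fps_sin (x - 1 / 2) * secant_half) $ n) has_real_derivative
      (fps_X * (fps_cos (x - 1 / 2) * secant_half)) $ n) (at x)" for n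
    using d(2)[of secant_half n x] by simp
  show "((\<lambda>x. - ((fps_X * (fps_sin (x - 1 / 2) * secant_half)) $ (2 * Suc k))) has_real_derivative
      - ((fps_cos (x - 1 / 2) * secant_half) $ (2 * k))) (at x)"
    using DERIV_minus[OF sin[of "Suc (2 * k)"]] by simp
  show "isCont (\<lambda>x. - ((fps_X * (fps_sin (x - 1 / 2) * secant_half)) $ (2 * k))) x"
    using DERIV_isCont[OF sin] by (cases "k = 0") (auto intro!: continuous_intros)
  show "(fps_cos (0 - 1 / 2) * secant_half) $ (2 * Suc k) = 0"
    "(fps_cos (1 - 1 / 2) * secant_half) $ (2 * Suc k) = 0"
    using cos_half_secant_half fps_cos_neg[of "1 / 2"] by simp_all
qed

text \<open>The series t sin (t x) / sin t begins with x t, hence the odd indices. It is 0 at x = 0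
  and t at x = 1, which gives the boundary conditions.\<close>

interpretation csc: dirichlet_sequence 1
  "\<lambda>k x. (fps_sin x * x_csc) $ (2 * k + 1)"
  "\<lambda>k x. (fps_X * (fps_cos x * x_csc)) $ (2 * k + 1)"
proof
  note d = fps_sin_mult_nth_has_derivative[where c = 0, simplified]
    fps_cos_mult_nth_has_derivative[where c = 0, simplified]
  fix k :: nat and x :: real
  show "(fps_sin x * x_csc) $ (2 * 0 + 1) = x ^ 1"
    by (simp add: fps_mult_nth x_csc_def)
  show "((\<lambda>x. (fps_sin x * x_csc) $ (2 * k + 1)) has_real_derivative
      (fps_X * (fps_cos x * x_csc)) $ (2 * k + 1)) (at x)"
    using d(1)[of x_csc "2 * k + 1" x] by simp
  show "((\<lambda>x. (fps_X * (fps_cos x * x_csc)) $ (2 * Suc k + 1)) has_real_derivative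
      - ((fps_sin x * x_csc) $ (2 * k + 1))) (at x)"
    using d(2)[of x_csc "2 * k + 2" x] by simp
  show "isCont (\<lambda>x. (fps_X * (fps_cos x * x_csc)) $ (2 * k + 1)) x"
    using DERIV_isCont[OF d(2)] by simp
  show "(fps_sin 0 * x_csc) $ (2 * Suc k + 1) = 0" by simp
  show "(fps_sin 1 * x_csc) $ (2 * Suc k + 1) = 0"
    unfolding sin_x_csc by simp
qed

lemma sec_half_limits:
  fixes n :: nat assumes "n \<ge> 1"
  shows "- ((fps_X * (fps_sin (1 - 1 / 2) * secant_half)) $ (2 * n)) = - (fps_tan (1 / 2) $ (2 * n - 1))"
    "- ((fps_X * (fps_sin (0 - 1 / 2) * secant_half)) $ (2 * n)) = fps_tan (1 / 2) $ (2 * n - 1)"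
  using assms fps_tan_half fps_sin_neg[of "1 / 2"] by simp_all

section \<open>Parity of coefficients and the Riccati equations\<close>

lemma fps_odd_convolution:
  fixes F G :: "real fps"
  assumes F: "\<And>i. even i \<Longrightarrow> F $ i = 0" and n: "n \<ge> 1"
  shows "(F * G) $ (2 * n - 2) = (\<Sum>i = 1..n - 1. F $ (2 * i - 1) * G $ (2 * (n - i) - 1))"
proof -
  have "(F * G) $ (2 * n - 2) = (\<Sum>j\<in>(\<lambda>i. 2 * i - 1) ` {1..n - 1}. F $ j * G $ (2 * n - 2 - j))"
    unfolding fps_mult_nth
  proof (rule sum.mono_neutral_right)
    show "(\<lambda>i. 2 * i - 1) ` {1..n - 1} \<subseteq> {0..2 * n - 2}" using n by auto
    have odd: "j \<in> (\<lambda>i. 2 * i - 1) ` {1..n - 1}" if "odd j" "j \<le> 2 * n - 2" for j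
    proof -
      obtain b where "j = 2 * b + 1" using \<open>odd j\<close> by (rule oddE)
      then show ?thesis using that(2) n by (intro image_eqI[of _ _ "Suc b"]) auto
    qed
    show "\<forall>j\<in>{0..2 * n - 2} - (\<lambda>i. 2 * i - 1) ` {1..n - 1}. F $ j * G $ (2 * n - 2 - j) = 0"
    proof
      fix j assume "j \<in> {0..2 * n - 2} - (\<lambda>i. 2 * i - 1) ` {1..n - 1}"
      then have "even j" using odd by auto
      then show "F $ j * G $ (2 * n - 2 - j) = 0" by (simp add: F)
    qed
  qed simp
  also have "\<dots> = (\<Sum>i = 1..n - 1. F $ (2 * i - 1) * G $ (2 * n - 2 - (2 * i - 1)))"
    by (subst sum.reindex) (auto simp: inj_on_def)
  also have "\<dots> = (\<Sum>i = 1..n - 1. F $ (2 * i - 1) * G $ (2 * (n - i) - 1))"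
    by (intro sum.cong refl arg_cong2[of _ _ _ _ "(*)"] arg_cong[of _ _ "fps_nth G"]) auto
  finally show ?thesis .
qed

lemma fps_even_convolution:
  fixes F G :: "real fps"
  assumes F: "\<And>i. odd i \<Longrightarrow> F $ i = 0"
  shows "(F * G) $ (2 * n) = (\<Sum>i\<le>n. F $ (2 * i) * G $ (2 * (n - i)))"
proof -
  have "(F * G) $ (2 * n) = (\<Sum>j\<in>(\<lambda>i. 2 * i) ` {..n}. F $ j * G $ (2 * n - j))"
    unfolding fps_mult_nth
  proof (rule sum.mono_neutral_right)
    show "\<forall>j\<in>{0..2 * n} - (\<lambda>i. 2 * i) ` {..n}. F $ j * G $ (2 * n - j) = 0"
    proof
      fix j assume j: "j \<in> {0..2 * n} - (\<lambda>i. 2 * i) ` {..n}"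
      then have "odd j" by (auto elim!: evenE)
      then show "F $ j * G $ (2 * n - j) = 0" by (simp add: F)
    qed
  qed auto
  also have "\<dots> = (\<Sum>i\<le>n. F $ (2 * i) * G $ (2 * n - 2 * i))"
    by (subst sum.reindex) (auto simp: inj_on_def)
  finally show ?thesis
    by (simp add: diff_mult_distrib2)
qed

text \<open>Being even means invariance under t -> -t, and this substitution commutes with
  inversion.\<close>

lemma inverse_nth_odd:
  fixes f :: "real fps"
  assumes "\<And>i. odd i \<Longrightarrow> f $ i = 0" "f $ 0 \<noteq> 0" "odd n"
  shows "inverse f $ n = 0"
proof -
  have "(- 1) ^ i * f $ i = f $ i" for i
    using assms(1)[of i] by (cases "even i") auto
  then have "f oo (- fps_X) = f"
    by (simp add: fps_compose_uminus' fps_eq_iff)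
  then have "inverse f oo (- fps_X) = inverse f"
    using assms(2) by (simp add: fps_inverse_compose)
  then have "(-1) ^ n * inverse f $ n = inverse f $ n"
    by (metis fps_compose_uminus' fps_nth_Abs_fps)
  then show ?thesis using \<open>odd n\<close> by simp
qed


lemma even_mult_nth_odd:
  fixes f g :: "real fps"
  assumes "\<And>i. odd i \<Longrightarrow> f $ i = 0" "\<And>i. odd i \<Longrightarrow> g $ i = 0" "odd n"
  shows "(f * g) $ n = 0"
  unfolding fps_mult_nth
proof (intro sum.neutral ballI)
  fix i assume "i \<in> {0..n}"
  then show "f $ i * g $ (n - i) = 0"
    using assms by (cases "even i") auto
qed

lemma fps_tan_nth_even:
  assumes "even n"
  shows "fps_tan (1 / 2 :: real) $ n = 0"
  unfolding fps_tan_half[symmetric] fps_mult_nth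
proof (intro sum.neutral ballI)
  fix i assume "i \<in> {0..n}"
  moreover have "secant_half $ j = 0" if "odd j" for j
    using that by (intro inverse_nth_odd) (auto simp: fps_cos_def)
  ultimately show "fps_sin (1 / 2) $ i * secant_half $ (n - i) = 0"
    using assms by (cases "even i") (auto simp: fps_sin_def)
qed

lemma fps_tan_recurrence:
  assumes "n \<ge> 2"
  shows "2 * (2 * real n - 1) * fps_tan (1 / 2) $ (2 * n - 1) =
    (\<Sum>i = 1..n - 1. fps_tan (1 / 2) $ (2 * i - 1) * fps_tan (1 / 2 :: real) $ (2 * (n - i) - 1))"
proof -
  let ?t = "fps_tan (1 / 2 :: real)"
  have "?t\<^sup>2 + 1 = ((fps_sin (1 / 2))\<^sup>2 + (fps_cos (1 / 2))\<^sup>2) * secant_half\<^sup>2"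
    unfolding fps_tan_half[symmetric] distrib_right power_mult_distrib[symmetric] cos_half_secant_half
    by simp
  also have "\<dots> = secant_half\<^sup>2"
    using fps_sin_cos_sum_of_squares[of "1 / 2 :: real"] by (simp add: add.commute)
  finally have "fps_deriv ?t = fps_const (1 / 2) * (1 + ?t\<^sup>2)"
    unfolding fps_tan_deriv by (simp add: fps_divide_unit fps_inverse_power add.commute)
  then have "fps_deriv ?t $ (2 * n - 2) = 1 / 2 * (1 + ?t\<^sup>2) $ (2 * n - 2)"
    by simp
  \<comment> \<open>For \<open>n \<ge> 2\<close> the index is positive, so the constant 1 drops
    out.\<close>
  also have "(1 + ?t\<^sup>2) $ (2 * n - 2) = (?t * ?t) $ (2 * n - 2)"
    using assms by (simp add: power2_eq_square)
  also have "\<dots> = (\<Sum>i = 1..n - 1. ?t $ (2 * i - 1) * ?t $ (2 * (n - i) - 1))"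
    using assms by (intro fps_odd_convolution fps_tan_nth_even) auto
  also have "fps_deriv ?t $ (2 * n - 2) = (2 * real n - 1) * ?t $ (2 * n - 1)"
  proof -
    have "2 * n - 2 + 1 = 2 * n - 1" using assms by simp
    then show ?thesis using assms by (simp add: of_nat_diff)
  qed
  finally show ?thesis by (simp add: algebra_simps)
qed

lemma x_cot_nth_odd:
  assumes "odd n"
  shows "x_cot $ n = 0"
  unfolding x_cot_def x_csc_def using assms
  by (intro even_mult_nth_odd inverse_nth_odd) (auto simp: fps_cos_def fps_sin_def)

lemma x_cot_0: "x_cot $ 0 = 1"
  by (simp add: x_cot_def x_csc_def)

text \<open>Multiplying by t keeps every term a power series. With u = sin t / t one has t u' = cos
  t - u, and differentiating u * (t / sin t) = 1 gives the derivative of t / sin t.\<close>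

lemma x_cot_riccati: "fps_X * fps_deriv x_cot = x_cot - x_cot\<^sup>2 - fps_X\<^sup>2"
proof -
  let ?u = "fps_shift 1 (fps_sin (1 :: real))"
  have u: "?u * x_csc = 1"
    unfolding x_csc_def by (rule inverse_mult_eq_1') simp
  have "fps_cos 1 = fps_deriv (fps_X * ?u)"
    unfolding fps_sin_1_eq[symmetric] fps_sin_deriv by simp
  also have "\<dots> = ?u + fps_X * fps_deriv ?u" by simp
  finally have cos: "fps_X * fps_deriv ?u = fps_cos 1 - ?u" by simp
  have "fps_deriv ?u * x_csc + ?u * fps_deriv x_csc = 0"
    using arg_cong[OF u, of fps_deriv] by (simp add: add.commute mult.commute)
  then have "x_csc * fps_X * (fps_deriv ?u * x_csc + ?u * fps_deriv x_csc) = 0" by simp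
  then have "x_csc * x_csc * (fps_X * fps_deriv ?u) + (?u * x_csc) * (fps_X * fps_deriv x_csc) = 0"
    by (simp add: algebra_simps)
  then have deriv_csc: "fps_X * fps_deriv x_csc = - (x_csc * x_csc * (fps_cos 1 - ?u))"
    unfolding u cos by (simp add: add_eq_0_iff)
  have "fps_X * fps_deriv x_cot = fps_cos 1 * (fps_X * fps_deriv x_csc) - fps_X * (fps_sin 1 * x_csc)"
    unfolding x_cot_def fps_deriv_mult fps_cos_deriv by (simp add: algebra_simps flip: fps_const_neg)
  also have "\<dots> = fps_cos 1 * x_csc * (?u * x_csc) - (fps_cos 1 * x_csc)\<^sup>2 - fps_X\<^sup>2"
    unfolding deriv_csc sin_x_csc by (simp add: algebra_simps power2_eq_square)
  finally show ?thesis
    unfolding u by (simp add: x_cot_def)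
qed

text \<open>The two end terms of the square contribute the coefficient twice, since the constant
  term is 1. Together with 2n from the derivative and -1 from the linear term this gives 2n + 1; the
  signs make the quadratic recurrence positive.\<close>

lemma x_cot_recurrence:
  assumes "n \<ge> 2"
  shows "(2 * real n + 1) * (- x_cot $ (2 * n)) =
    (\<Sum>i = 1..n - 1. (- x_cot $ (2 * i)) * (- x_cot $ (2 * (n - i))))"
proof -
  have "(fps_X * fps_deriv x_cot) $ (2 * n) = x_cot $ (2 * n) - (x_cot * x_cot) $ (2 * n) - (fps_X\<^sup>2 :: real fps) $ (2 * n)"
    unfolding x_cot_riccati by (simp add: power2_eq_square)
  moreover have "(fps_X\<^sup>2 :: real fps) $ (2 * n) = 0"
    using assms by (simp add: fps_X_power_nth)
  moreover have "(fps_X * fps_deriv x_cot) $ (2 * n) = 2 * real n * x_cot $ (2 * n)"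
    using assms by (simp add: fps_X_mult_nth of_nat_diff)
  moreover have "(x_cot * x_cot) $ (2 * n) = 2 * x_cot $ (2 * n) + (\<Sum>i = 1..n - 1. x_cot $ (2 * i) * x_cot $ (2 * (n - i)))"
  proof -
    have "{..n} = insert 0 (insert n {1..n - 1})" using assms by auto
    moreover have "(x_cot * x_cot) $ (2 * n) = (\<Sum>i\<le>n. x_cot $ (2 * i) * x_cot $ (2 * (n - i)))"
      by (intro fps_even_convolution x_cot_nth_odd)
    ultimately show ?thesis
      using assms by (simp add: x_cot_0)
  qed
  ultimately show ?thesis by (simp add: algebra_simps)
qed

section \<open>The recurrences\<close>

lemma num_syt_strip_eq:
  assumes "r \<le> 1" "q \<le> 1"
    and lim: "(\<lambda>m. (\<Sum>v\<in>{1..<m}. transfer m (\<lambda>v. real v ^ r) k v * real v ^ q) /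
                 real m ^ (3 * k + r + q + 1)) \<longlonglongrightarrow> l"
  shows "real (num_syt (strip r q (Suc k))) = fact (3 * k + r + q + 1) * l"
proof -
  have "(\<lambda>m. (\<Sum>v\<in>{1..<m}. transfer m (\<lambda>v. real v ^ r) k v * real v ^ q) /
            real m ^ (3 * k + r + q + 1))
      \<longlonglongrightarrow> real (num_syt (strip r q (Suc k))) / fact (3 * k + r + q + 1)"
    using weak_maps_asymptotics[OF finite_strip young_order_subset irrefl_young_order, of r q "Suc k"]
    unfolding card_weak_maps_strip[OF assms(1,2)] num_syt_eq card_strip[OF assms(1,2)] .
  with lim have "real (num_syt (strip r q (Suc k))) / fact (3 * k + r + q + 1) = l"
    by (rule LIMSEQ_unique[symmetric])
  then show ?thesis
    by (subst (asm) nonzero_divide_eq_eq[OF fact_nonzero]) (simp only: mult.commute)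
qed

text \<open>The slopes at the two ends of [0,1] are opposite, so the tangent coefficient appears
  twice.\<close>

lemma num_syt_sigma_first:
  assumes "n \<ge> 1"
  shows "real (num_syt (sigma (3 * n - 2))) = fact (3 * n - 2) * (2 * fps_tan (1 / 2) $ (2 * n - 1))"
proof -
  obtain k where k: "n = Suc k" using assms by (cases n) auto
  have "3 * k + 0 + 0 + 1 = 3 * n - 2" by (simp add: k)
  then have "real (num_syt (strip 0 0 n)) =
      fact (3 * n - 2) * (fps_tan (1 / 2) $ (2 * n - 1) - - (fps_tan (1 / 2) $ (2 * n - 1)))"
    using num_syt_strip_eq[OF zero_le_one zero_le_one sec_half.transfer_sum_tendsto_0[of k]]
    by (simp only: k[symmetric] sec_half_limits[OF assms])
  then show ?thesis
    by (simp add: sigma_first_eq_strip[OF assms])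
qed

text \<open>The half-angle formula (1 - cos t) / sin t = tan (t/2). Through it a strip with one end
  box, solved by t sin (t x) / sin t, is still counted by the tangent.\<close>

lemma one_minus_cos_x_csc: "(1 - fps_cos 1) * x_csc = fps_X * fps_tan (1 / 2)"
proof -
  let ?s = "fps_sin (1 / 2 :: real)" and ?c = "fps_cos (1 / 2 :: real)"
  have "fps_sin 1 * fps_tan (1 / 2) = 2 * ?s\<^sup>2 * (?c * secant_half)"
    using fps_sin_add[of "1 / 2 :: real" "1 / 2"]
    by (simp add: power2_eq_square algebra_simps flip: fps_tan_half)
  moreover have "1 - fps_cos 1 = 2 * ?s\<^sup>2"
  proof -
    have "fps_cos 1 = ?c\<^sup>2 - ?s\<^sup>2"
      using fps_cos_add[of "1 / 2 :: real" "1 / 2"] by (simp add: power2_eq_square)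
    then have "1 - fps_cos 1 = (?c\<^sup>2 + ?s\<^sup>2) - (?c\<^sup>2 - ?s\<^sup>2)"
      by (simp only: fps_sin_cos_sum_of_squares)
    then show ?thesis by simp
  qed
  ultimately have "(1 - fps_cos 1) * x_csc = (fps_sin 1 * x_csc) * fps_tan (1 / 2)"
    by (simp add: cos_half_secant_half mult_ac)
  then show ?thesis
    by (simp only: sin_x_csc)
qed

lemma num_syt_sigma_second:
  assumes "n \<ge> 1"
  shows "real (num_syt (sigma (3 * n - 1))) = fact (3 * n - 1) * fps_tan (1 / 2) $ (2 * n - 1)"
proof -
  obtain k where k: "n = Suc k" using assms by (cases n) auto
  have "(fps_X * (fps_cos 0 * x_csc)) $ (2 * n + 1) - (fps_X * (fps_cos 1 * x_csc)) $ (2 * n + 1) =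
      ((1 - fps_cos 1) * x_csc) $ (2 * n)"
    by (simp add: left_diff_distrib)
  also have "\<dots> = fps_tan (1 / 2) $ (2 * n - 1)"
    unfolding one_minus_cos_x_csc using assms by simp
  finally have l: "(fps_X * (fps_cos 0 * x_csc)) $ (2 * n + 1) - (fps_X * (fps_cos 1 * x_csc)) $ (2 * n + 1) =
    fps_tan (1 / 2) $ (2 * n - 1)" .
  have "3 * k + 1 + 0 + 1 = 3 * n - 1" by (simp add: k)
  then show ?thesis
    using num_syt_strip_eq[OF order_refl zero_le_one csc.transfer_sum_tendsto_0[of k]]
    by (simp only: l sigma_second_eq_strip[OF assms] k[symmetric])
qed

lemma num_syt_tau:
  assumes "n \<ge> 1"
  shows "real (num_syt (tau (3 * n))) = fact (3 * n) * (- x_cot $ (2 * n))"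
proof -
  obtain k where k: "n = Suc k" using assms by (cases n) auto
  have l: "- ((fps_X * (fps_cos 1 * x_csc)) $ (2 * n + 1)) = - x_cot $ (2 * n)"
    by (simp add: x_cot_def)
  have "3 * k + 1 + 1 + 1 = 3 * n" by (simp add: k)
  then show ?thesis
    using num_syt_strip_eq[OF order_refl order_refl csc.transfer_sum_tendsto_1[of k]]
    by (simp only: l tau_eq_strip[OF assms] k[symmetric])
qed

text \<open>The normalisation of exponential generating functions: a binomial convolution of counts
  becomes a plain convolution of coefficients.\<close>

lemma binomial_mult_facts:
  assumes "a + b = n"
  shows "real (n choose a) * (fact a * x) * (fact b * y) = fact n * (x * y)"
proof -
  have "fact a * fact b * real (n choose a) = fact n"
    using binomial_fact_lemma[of a n] assms by (metis add_diff_cancel_left' le_add1 of_nat_fact of_nat_mult)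
  then show ?thesis by (metis (no_types, lifting) mult.assoc mult.left_commute)
qed

theorem theorem2p2:
  fixes n :: nat
  assumes "n \<ge> 2"
  shows "real (num_syt (sigma (3 * n - 2))) =
           1 / (2 * real n - 1) *
             (\<Sum>i = 1..n - 1. real ((3 * n - 2) choose (3 * i - 1)) *
                real (num_syt (sigma (3 * i - 1))) * real (num_syt (sigma (3 * n - 3 * i - 1))))
       \<and> real (num_syt (tau (3 * n))) =
           1 / (2 * real n + 1) *
             (\<Sum>i = 1..n - 1. real ((3 * n) choose (3 * i)) *
                real (num_syt (tau (3 * i))) * real (num_syt (tau (3 * n - 3 * i))))"
proof
  let ?t = "fps_tan (1 / 2 :: real)"
  have "(\<Sum>i = 1..n - 1. real ((3 * n - 2) choose (3 * i - 1)) *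
          real (num_syt (sigma (3 * i - 1))) * real (num_syt (sigma (3 * n - 3 * i - 1)))) =
        (\<Sum>i = 1..n - 1. fact (3 * n - 2) * (?t $ (2 * i - 1) * ?t $ (2 * (n - i) - 1)))"
  proof (rule sum.cong[OF refl])
    fix i assume i: "i \<in> {1..n - 1}"
    have "3 * n - 3 * i - 1 = 3 * (n - i) - 1" by (simp add: diff_mult_distrib2)
    moreover have "3 * i - 1 + (3 * (n - i) - 1) = 3 * n - 2" "n - i \<ge> 1" "i \<ge> 1"
      using i by auto
    ultimately show "real ((3 * n - 2) choose (3 * i - 1)) *
          real (num_syt (sigma (3 * i - 1))) * real (num_syt (sigma (3 * n - 3 * i - 1))) =
        fact (3 * n - 2) * (?t $ (2 * i - 1) * ?t $ (2 * (n - i) - 1))"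
      by (simp only: num_syt_sigma_second binomial_mult_facts)
  qed
  \<comment> \<open>The factor 2 of the tangent recurrence is the one in
    \<open>num_syt_sigma_first\<close>.\<close>
  also have "\<dots> = fact (3 * n - 2) * (2 * (2 * real n - 1) * ?t $ (2 * n - 1))"
    unfolding fps_tan_recurrence[OF assms] by (simp add: sum_distrib_left)
  also have "\<dots> = (2 * real n - 1) * real (num_syt (sigma (3 * n - 2)))"
    using assms by (simp add: num_syt_sigma_first)
  finally show "real (num_syt (sigma (3 * n - 2))) = 1 / (2 * real n - 1) *
      (\<Sum>i = 1..n - 1. real ((3 * n - 2) choose (3 * i - 1)) *
          real (num_syt (sigma (3 * i - 1))) * real (num_syt (sigma (3 * n - 3 * i - 1))))"
    using assms by simp
  have "(\<Sum>i = 1..n - 1. real ((3 * n) choose (3 * i)) *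
          real (num_syt (tau (3 * i))) * real (num_syt (tau (3 * n - 3 * i)))) =
        (\<Sum>i = 1..n - 1. fact (3 * n) * ((- x_cot $ (2 * i)) * (- x_cot $ (2 * (n - i)))))"
  proof (rule sum.cong[OF refl])
    fix i assume i: "i \<in> {1..n - 1}"
    have "3 * n - 3 * i = 3 * (n - i)" by (simp add: diff_mult_distrib2)
    moreover have "3 * i + 3 * (n - i) = 3 * n" "n - i \<ge> 1" "i \<ge> 1"
      using i by auto
    ultimately show "real ((3 * n) choose (3 * i)) *
          real (num_syt (tau (3 * i))) * real (num_syt (tau (3 * n - 3 * i))) =
        fact (3 * n) * ((- x_cot $ (2 * i)) * (- x_cot $ (2 * (n - i))))"
      by (simp only: num_syt_tau binomial_mult_facts)
  qed
  also have "\<dots> = fact (3 * n) * ((2 * real n + 1) * (- x_cot $ (2 * n)))"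
    unfolding x_cot_recurrence[OF assms] by (simp only: sum_distrib_left)
  finally show "real (num_syt (tau (3 * n))) = 1 / (2 * real n + 1) *
      (\<Sum>i = 1..n - 1. real ((3 * n) choose (3 * i)) *
          real (num_syt (tau (3 * i))) * real (num_syt (tau (3 * n - 3 * i))))"
    using num_syt_tau[of n] assms by simp
qed

end
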